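(* Let $I$ be an interval of heat times $\tau$ and let $z(\tau)=x(\tau)+iy(\tau)$, $\tau\in I$, with $y(\tau)>0$, be a branch of zeros of $H_\tau$ such that for every $\tau\in I$ the zero $z(\tau)$ is simple and has maximal imaginary height, i.e. every zero $\rho$ of $H_\tau$ satisfies $|\operatorname{Im}\rho|\le y(\tau)$. Then along $I$ $$\frac{\mathrm d}{\mathrm d\tau}\,y(\tau)^2\le -2-4\,y(\tau)^2\,\mathcal G_\tau(z(\tau)).$$ In particular, since $\mathcal G_\tau\ge 0$, dropping the collective term gives the classical estimate $\frac{\mathrm d}{\mathrm d\tau}y(\tau)^2\le-2$.
   Context: For real $\tau$ (heat time), $H_\tau(z)=\int_0^\infty e^{\tau u^2}\Phi(u)\cos(zu)\,\mathrm du$, where $\Phi(u)=\sum_{n\ge1}(2\pi^2n^4e^{9u}-3\pi n^2e^{5u})e^{-\pi n^2e^{4u}}$. $H_\tau$ is an even entire function of $z$, real on the real axis, so its zeros are symmetric under $\rho\mapsto\bar\rho$ and $\rho\mapsto-\rho$. A branch of zeros is a continuous function $z(\tau)$ with $H_\tau(z(\tau))=0$; it is differentiable where the zero is simple. For a maximal-height zero $z=x+iy$, $y>0$, of $H_\tau$, define $$\mathcal G_\tau(z)=\sum_{\rho\ne z,\bar z}\frac{1}{(\operatorname{Re}\rho-x)^2+4y^2},$$ the sum being over all zeros $\rho$ of $H_\tau$ other than $z,\bar z$, counted with multiplicity. *)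

theory Defs
  imports "HOL-Complex_Analysis.Complex_Analysis"
begin

text \<open>The series for \<open>\<Phi>\<close> runs over \<open>n \<ge> 1\<close>, hence the shift to \<^term>\<open>Suc n\<close>.\<close>

definition Phi :: "real \<Rightarrow> real" where
  "Phi u = (\<Sum>n. (2 * pi^2 * real (Suc n)^4 * exp (9*u) - 3 * pi * real (Suc n)^2 * exp (5*u))
                 * exp (- pi * real (Suc n)^2 * exp (4*u)))"

definition H :: "real \<Rightarrow> complex \<Rightarrow> complex" where
  "H \<tau> z = (LINT u:{0..}|lborel. of_real (exp (\<tau> * u^2) * Phi u) * cos (z * of_real u))"

definition zeros :: "real \<Rightarrow> complex set" where
  "zeros \<tau> = {\<rho>. H \<tau> \<rho> = 0}"

definition simple_zero :: "real \<Rightarrow> complex \<Rightarrow> bool" where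
  "simple_zero \<tau> z \<longleftrightarrow> z \<in> zeros \<tau> \<and> zorder (H \<tau>) z = 1"

definition maximal_height_zero :: "real \<Rightarrow> complex \<Rightarrow> bool" where
  "maximal_height_zero \<tau> z \<longleftrightarrow> z \<in> zeros \<tau> \<and> (\<forall>\<rho>\<in>zeros \<tau>. \<bar>Im \<rho>\<bar> \<le> Im z)"

definition zero_branch :: "real set \<Rightarrow> (real \<Rightarrow> complex) \<Rightarrow> bool" where
  "zero_branch I z \<longleftrightarrow> continuous_on I z \<and> (\<forall>\<tau>\<in>I. z \<tau> \<in> zeros \<tau>)"

text \<open>The summand belonging to a zero \<open>\<rho>\<close> is weighted by its multiplicity
  \<^term>\<open>zorder (H \<tau>) \<rho>\<close>.  As \<^const>\<open>infsum\<close> is \<open>0\<close> for divergent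
  families, statements about \<open>G\<close> should come with the summability of \<open>G_term\<close>.\<close>

definition G_term :: "real \<Rightarrow> complex \<Rightarrow> complex \<Rightarrow> real" where
  "G_term \<tau> z \<rho> = of_int (zorder (H \<tau>) \<rho>) / ((Re \<rho> - Re z)^2 + 4 * (Im z)^2)"

definition G :: "real \<Rightarrow> complex \<Rightarrow> real" where
  "G \<tau> z = (\<Sum>\<^sub>\<infinity>\<rho>\<in>zeros \<tau> - {z, cnj z}. G_term \<tau> z \<rho>)"

end

theory Submission
  imports Defs "HOL-Real_Asymp.Real_Asymp"
begin

text \<open>
  Differentiating under the integral sign gives the backward heat equation
  \<open>\<partial>\<^sub>\<tau> H = - H''\<close>, primes denoting derivatives in \<open>z\<close>.  Hence a simple zero moves with the velocity
  \<open>z' = H''(z) / H'(z)\<close> (\<open>zero_branch_velocity\<close>), and everything reduces to an upper bound for the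
  imaginary part of \<open>H''/H'\<close> at a highest zero \<open>a = x + iy\<close>.

  If \<open>H\<close> has a partial fraction expansion, then \<open>H''(a) / (2 H'(a))\<close> is a sum of \<open>1 / (a - \<rho>)\<close> over the other
  zeros.  The conjugate zero contributes the imaginary part \<open>- 1 / (2y)\<close>.  A zero
  \<open>\<rho> = \<xi> + i\<eta>\<close> contributes \<open>- (y - \<eta>) / ((\<xi> - x)\<^sup>2 + (y - \<eta>)\<^sup>2)\<close>, and as \<open>0 \<le> y - \<eta> \<le> 2y\<close>, this
  is at most \<open>- (y - \<eta>) / ((\<xi> - x)\<^sup>2 + 4y\<^sup>2)\<close>.  When these bounds are added up, the terms with the
  numerator \<open>\<eta>\<close> cancel between conjugate zeros, and \<open>- y\<close> times the sum defining \<open>G\<close> remains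
  (\<open>Im_deriv_ratio_at_highest_zero\<close>).  Multiplying by \<open>4y\<close> gives the theorem.

  A weak form of the Hadamard expansion is enough.  Let \<open>f\<close> be entire with \<open>log |f(z)| = o(|z|\<^sup>2)\<close>.
  Dividing \<open>f\<close> by its zeros in the disc of radius \<open>R\<close> around \<open>c\<close> leaves a function \<open>Q\<close> without zeros
  there whose logarithm has real part at most \<open>o(R\<^sup>2)\<close> relative to \<open>c\<close>; by Borel-Caratheodory and
  Cauchy the second derivative of \<open>log Q\<close> tends to \<open>0\<close> near \<open>c\<close>.  So the truncated partial fractions
  converge once the value of the logarithmic derivative at \<open>c\<close> is subtracted
  (\<open>partial_fractions_at_simple_zero\<close>).  For \<open>f\<close> real on the real axis and \<open>c\<close> real, the subtracted
  value is real, so it is invisible in the imaginary part.  The terms of \<open>G\<close> are nonnegative and the bound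
  holds for all finite partial sums, so it gives the summability of the family along with the estimate for its sum.
\<close>

section \<open>Holomorphic functions with real part bounded above\<close>

text \<open>
  The Moebius map \<open>w \<mapsto> w / (2A - w)\<close> sends the half plane \<open>Re w < A\<close> into the unit disc and fixes
  \<open>0\<close>, so the Schwarz lemma applies to its composition with \<open>L\<close>.
\<close>

lemma borel_caratheodory_half_radius:
  assumes hol: "L holomorphic_on ball c R" and R: "0 < R" and A: "0 < A"
    and L0: "L c = 0" and Re: "\<And>w. w \<in> ball c R \<Longrightarrow> Re (L w) < A"
    and w: "dist c w \<le> R / 2"
  shows "norm (L w) \<le> 2 * A"
proof -
  have lt: "norm (L v) < norm (of_real (2 * A) - L v)" if "v \<in> ball c R" for v
  proof -
    have "A * Re (L v) < A * A" using Re[OF that] A by simp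
    then have "(cmod (L v))\<^sup>2 < (cmod (of_real (2 * A) - L v))\<^sup>2"
      unfolding cmod_power2 by (simp add: power2_eq_square algebra_simps)
    then show ?thesis by (rule power2_less_imp_less) simp
  qed
  define \<phi> where "\<phi> = (\<lambda>u. L (c + of_real R * u) / (of_real (2 * A) - L (c + of_real R * u)))"
  have inb: "c + of_real R * u \<in> ball c R" if "norm u < 1" for u
    using that R by (simp add: dist_norm norm_mult)
  have nz: "of_real (2 * A) - L (c + of_real R * u) \<noteq> 0" if "norm u < 1" for u
    using lt[OF inb[OF that]] by force
  have Lc: "(\<lambda>u. L (c + of_real R * u)) holomorphic_on ball 0 1"
    using inb by (intro holomorphic_on_compose_gen[OF _ hol, unfolded o_def] holomorphic_intros) auto
  have "\<phi> holomorphic_on ball 0 1"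
    unfolding \<phi>_def using nz by (intro holomorphic_intros Lc) auto
  moreover have "\<phi> 0 = 0" by (simp add: \<phi>_def L0)
  moreover have "norm (\<phi> u) < 1" if "norm u < 1" for u
    using lt[OF inb[OF that]] nz[OF that] by (simp add: \<phi>_def norm_divide)
  moreover have u: "norm ((w - c) / of_real R) < 1"
    using w R by (simp add: norm_divide dist_norm norm_minus_commute divide_simps)
  ultimately have "norm (\<phi> ((w - c) / of_real R)) \<le> norm ((w - c) / of_real R)"
    by (intro Schwarz_Lemma(1))
  also have "\<dots> \<le> 1/2"
    using w R by (simp add: norm_divide dist_norm norm_minus_commute divide_simps)
  finally have "norm (L w) / norm (of_real (2 * A) - L w) \<le> 1/2"
    using R by (simp add: \<phi>_def norm_divide)
  then have "2 * norm (L w) \<le> norm (of_real (2 * A) - L w)"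
    using nz[OF u] R by (simp add: divide_simps split: if_splits)
  also have "\<dots> \<le> 2 * A + norm (L w)"
    using norm_triangle_ineq4[of "of_real (2*A)" "L w"] A by simp
  finally show ?thesis by simp
qed

text \<open>
  Cauchy's inequality on discs of radius \<open>R / 4\<close> turns the Borel-Caratheodory bound \<open>2A\<close> into the bound
  \<open>64 A / R\<^sup>2\<close> for the second derivative.  Only this derivative is useful here: for \<open>A = o(R\<^sup>2)\<close> it
  becomes small, while the first derivative need not.
\<close>

lemma deriv_diff_le_of_Re_le:
  assumes hol: "L holomorphic_on ball c R" and R: "0 < R" and A: "0 < A"
    and L0: "L c = 0" and Re: "\<And>w. w \<in> ball c R \<Longrightarrow> Re (L w) < A"
    and w: "dist c w < R / 4"
  shows "norm (deriv L w - deriv L c) \<le> 64 * A * norm (w - c) / R\<^sup>2"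
proof -
  have bd: "norm ((deriv ^^ 2) L v) \<le> 64 * A / R\<^sup>2" if v: "v \<in> ball c (R/4)" for v
  proof -
    have sub: "cball v (R/4) \<subseteq> cball c (R/2)"
    proof
      fix x assume "x \<in> cball v (R/4)"
      then show "x \<in> cball c (R/2)" using v dist_triangle[of c x v] by (auto simp: dist_commute)
    qed
    have sub2: "cball v (R/4) \<subseteq> ball c R" using sub R by (force simp: subset_iff)
    have "norm ((deriv ^^ 2) L v) \<le> fact 2 * (2 * A) / (R/4)^2"
    proof (rule Cauchy_inequality)
      show "L holomorphic_on ball v (R/4)" 
        using hol sub2 ball_subset_cball holomorphic_on_subset by blast
      show "continuous_on (cball v (R/4)) L"
        using hol sub2 holomorphic_on_imp_continuous_on continuous_on_subset by blast
      show "norm (L x) \<le> 2 * A" if "norm (v - x) = R/4" for x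
      proof (rule borel_caratheodory_half_radius[OF hol R A L0 Re])
        have "x \<in> cball v (R/4)" using that by (simp add: dist_norm)
        then show "dist c x \<le> R/2" using sub by auto
      qed auto
    qed (use R in auto)
    then show ?thesis by (simp add: power_divide fact_numeral)
  qed
  have "norm (deriv L w - deriv L c) \<le> 64 * A / R\<^sup>2 * norm (w - c)"
  proof (rule field_differentiable_bound[where S = "ball c (R/4)" and f' = "(deriv ^^ 2) L"])
    fix v assume v: "v \<in> ball c (R/4)"
    have "deriv L holomorphic_on ball c R" using hol by (intro holomorphic_deriv) auto
    moreover have "v \<in> ball c R" using v R by auto
    ultimately have "(deriv L has_field_derivative deriv (deriv L) v) (at v)"
      by (auto intro: holomorphic_derivI)
    then show "(deriv L has_field_derivative (deriv ^^ 2) L v) (at v within ball c (R/4))"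
      by (simp add: eval_nat_numeral has_field_derivative_at_within)
  qed (use bd w R in auto)
  then show ?thesis by (simp add: field_simps)
qed

section \<open>Dividing out the zeros in a disc\<close>

text \<open>
  Inside the ball \<open>Q\<close> comes from the factorization of holomorphic functions with equal zero orders, outside it is
  the plain quotient; both agree away from the zeros in the ball.
\<close>

lemma factor_out_zeros_in_ball:
  assumes hol: "f holomorphic_on UNIV" and Z: "Z = {w \<in> ball c R. f w = 0}" and fin: "finite Z"
    and nz: "\<exists>w. f w \<noteq> 0"
  obtains Q where "Q holomorphic_on UNIV" "\<And>w. w \<in> ball c R \<Longrightarrow> Q w \<noteq> 0"
    "\<And>w. f w = Q w * (\<Prod>\<rho>\<in>Z. (w - \<rho>) ^ nat (zorder f \<rho>))"
proof -
  define P where "P = (\<lambda>w. \<Prod>\<rho>\<in>Z. (w - \<rho>) ^ nat (zorder f \<rho>))"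
  have pos: "zorder f w > 0" if "f w = 0" for w
    using zorder_exist_zero[OF hol open_UNIV connected_UNIV UNIV_I, of w] nz that by auto
  have zero: "zorder f w = 0" if "f w \<noteq> 0" for w
    using zorder_exist_zero[OF hol open_UNIV connected_UNIV UNIV_I, of w] nz that by auto
  have Zpos: "nat (zorder f \<rho>) > 0" if "\<rho> \<in> Z" for \<rho>
    using that pos[of \<rho>] unfolding Z by simp
  have P0: "P w = 0 \<longleftrightarrow> w \<in> Z" for w
    using Zpos by (force simp: P_def prod_zero_iff[OF fin])
  have zP: "zorder P w = zorder f w" if "w \<in> ball c R" for w
  proof (rule zorder_eqI[of UNIV])
    show "(\<lambda>v. \<Prod>\<rho>\<in>Z - {w}. (v - \<rho>) ^ nat (zorder f \<rho>)) holomorphic_on UNIV"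
      by (intro holomorphic_intros)
    show "(\<Prod>\<rho>\<in>Z - {w}. (w - \<rho>) ^ nat (zorder f \<rho>)) \<noteq> 0"
      using fin by auto
    fix v assume "v \<noteq> w"
    show "P v = (\<Prod>\<rho>\<in>Z - {w}. (v - \<rho>) ^ nat (zorder f \<rho>)) * (v - w) powi zorder f w"
    proof (cases "w \<in> Z")
      case True
      then have "zorder f w > 0" using pos[of w] Z by simp
      then show ?thesis unfolding P_def prod.remove[OF fin True] by (simp add: power_int_def)
    next
      case False
      then have "zorder f w = 0" using zero[of w] Z that by simp
      then show ?thesis unfolding P_def using False by simp
    qed
  qed auto
  have holP: "P holomorphic_on A" for A unfolding P_def by (intro holomorphic_intros)
  obtain h where h: "h holomorphic_on ball c R" "\<And>w. w \<in> ball c R \<Longrightarrow> h w \<noteq> 0"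
     "\<And>w. w \<in> ball c R \<Longrightarrow> f w = h w * P w"
  proof (rule holomorphic_zorder_factorization[of f "ball c R" P])
    show "f holomorphic_on ball c R" using hol holomorphic_on_subset by blast
    show "P w = 0 \<longleftrightarrow> f w = 0" if "w \<in> ball c R" for w
      using P0[of w] that unfolding Z by simp
  qed (simp_all add: holP zP that)
  define Q where "Q = (\<lambda>w. if w \<in> ball c R then h w else f w / P w)"
  have Qeq: "Q w = f w / P w" if "w \<notin> Z" for w
    using that P0 h(3)[of w] by (auto simp: Q_def)
  have "Q holomorphic_on ball c R \<union> (- Z)"
  proof (rule holomorphic_on_Un)
    show "Q holomorphic_on ball c R" by (rule holomorphic_transform[OF h(1)]) (simp add: Q_def)
    show "Q holomorphic_on -Z"
    proof (rule holomorphic_transform)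
      show "(\<lambda>w. f w / P w) holomorphic_on - Z"
        using P0 by (intro holomorphic_intros holP holomorphic_on_subset[OF hol]) auto
    qed (use Qeq in auto)
  qed (use fin finite_imp_closed in auto)
  moreover have "ball c R \<union> (- Z) = UNIV" using Z by auto
  ultimately have "Q holomorphic_on UNIV" by simp
  moreover have "f w = Q w * P w" for w
    using h(3)[of w] P0[of w] Z by (cases "w \<in> ball c R") (simp_all add: Q_def)
  moreover have "Q w \<noteq> 0" if "w \<in> ball c R" for w using that h(2) by (simp add: Q_def)
  ultimately show ?thesis using that unfolding P_def by blast
qed

text \<open>
  On the circle of radius \<open>2R\<close> every \<open>|w - \<rho>|\<close> is at least \<open>R\<close>, hence at least \<open>|c - \<rho>|\<close>.  There the
  product over the zeros is not smaller than at \<open>c\<close>, so a relative bound on \<open>f\<close> passes to \<open>Q\<close>, and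
  the maximum principle carries it into the disc.
\<close>

lemma zero_free_part_bound:
  assumes Qhol: "Q holomorphic_on UNIV" and Qnz: "Q c \<noteq> 0" and R: "0 < R"
    and Z: "Z \<subseteq> ball c R" "finite Z" "c \<notin> Z"
    and f: "\<And>w. f w = Q w * (\<Prod>\<rho>\<in>Z. (w - \<rho>) ^ m \<rho>)"
    and bd: "\<And>w. dist c w = 2 * R \<Longrightarrow> norm (f w) \<le> B * norm (f c)"
    and w: "dist c w \<le> 2 * R"
  shows "norm (Q w) \<le> B * norm (Q c)"
proof (rule maximum_modulus_frontier[of Q "cball c (2*R)"])
  fix v assume "v \<in> frontier (cball c (2*R))"
  then have v: "dist c v = 2 * R" using R by (simp add: frontier_cball)
  define P where "P = (\<lambda>w. \<Prod>\<rho>\<in>Z. (w - \<rho>) ^ m \<rho>)"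
  have "P c \<noteq> 0" using Z by (auto simp: P_def)
  have ge: "norm (P c) \<le> norm (P v)"
    unfolding P_def prod_norm[symmetric] norm_power
  proof (intro prod_mono conjI power_mono)
    fix \<rho> assume "\<rho> \<in> Z"
    then have "dist c \<rho> < R" using Z by auto
    then show "cmod (c - \<rho>) \<le> cmod (v - \<rho>)"
      using v dist_triangle[of c v \<rho>] by (simp add: dist_norm norm_minus_commute)
  qed auto
  have "norm (Q v) * norm (P c) \<le> norm (Q v) * norm (P v)"
    using ge by (intro mult_left_mono) auto
  also have "\<dots> = norm (f v)" by (simp add: f P_def norm_mult)
  also have "\<dots> \<le> B * norm (f c)" by (rule bd[OF v])
  also have "\<dots> = B * norm (Q c) * norm (P c)" by (simp add: f P_def norm_mult)
  finally show "norm (Q v) \<le> B * norm (Q c)" using \<open>P c \<noteq> 0\<close> by simp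
next
  show "Q holomorphic_on interior (cball c (2*R))" "continuous_on (closure (cball c (2*R))) Q"
    using Qhol holomorphic_on_imp_continuous_on holomorphic_on_subset continuous_on_subset by blast+
qed (use w in auto)

text \<open>
  The logarithmic derivative of \<open>Q\<close> is the derivative of a holomorphic logarithm of \<open>Q\<close>, to which
  \<open>deriv_diff_le_of_Re_le\<close> applies.  The \<open>+ 1\<close> makes the bound on the real part strict and positive.
\<close>

lemma zero_free_part_logderiv:
  assumes Qhol: "Q holomorphic_on UNIV" and Qnz: "\<And>w. w \<in> ball c R \<Longrightarrow> Q w \<noteq> 0" and R: "0 < R"
    and bd: "\<And>w. w \<in> ball c R \<Longrightarrow> norm (Q w) \<le> exp A * norm (Q c)" and A: "0 \<le> A"
    and w: "dist c w < R / 4"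
  shows "norm (deriv Q w / Q w - deriv Q c / Q c) \<le> 64 * (A + 1) * norm (w - c) / R\<^sup>2"
proof -
  obtain g where g: "g holomorphic_on ball c R" "\<And>x. x \<in> ball c R \<Longrightarrow> exp (g x) = Q x"
  proof (rule holomorphic_logarithm_exists[of "ball c R" Q c])
    show "Q holomorphic_on ball c R" using Qhol holomorphic_on_subset by blast
  qed (use Qnz R in auto)
  define L where "L = (\<lambda>x. g x - g c)"
  have Lhol: "L holomorphic_on ball c R" unfolding L_def by (intro holomorphic_intros g)
  have dL: "deriv L x = deriv Q x / Q x" if x: "x \<in> ball c R" for x
  proof -
    have 1: "(g has_field_derivative deriv g x) (at x)"
      using g(1) x by (auto intro: holomorphic_derivI)
    then have "((\<lambda>x. exp (g x)) has_field_derivative exp (g x) * deriv g x) (at x)"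
      by (auto intro!: derivative_eq_intros)
    then have "(Q has_field_derivative exp (g x) * deriv g x) (at x)"
      by (rule has_field_derivative_transform_within_open[of _ _ _ "ball c R"]) (use x in \<open>auto simp: g\<close>)
    then have "deriv Q x = Q x * deriv g x" using g(2)[OF x] by (simp add: DERIV_imp_deriv)
    moreover have "deriv L x = deriv g x"
      unfolding L_def by (rule DERIV_imp_deriv) (auto intro!: derivative_eq_intros 1)
    ultimately show ?thesis using Qnz[OF x] by simp
  qed
  have "norm (deriv L w - deriv L c) \<le> 64 * (A + 1) * norm (w - c) / R\<^sup>2"
  proof (rule deriv_diff_le_of_Re_le[OF Lhol R])
    fix x assume x: "x \<in> ball c R"
    have "exp (Re (L x)) = norm (exp (L x))" by simp
    also have "\<dots> = norm (Q x) / norm (Q c)" using g(2)[OF x] g(2)[of c] R by (simp add: L_def exp_diff norm_divide)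
    also have "\<dots> \<le> exp A" using bd[OF x] Qnz[of c] R by (simp add: divide_simps)
    finally show "Re (L x) < A + 1" by simp
  qed (use A w in \<open>auto simp: L_def\<close>)
  then show ?thesis using dL[of w] dL[of c] w R by auto
qed

section \<open>Partial fractions for entire functions of subquadratic growth\<close>

lemma zero_product_has_derivative:
  fixes w :: complex
  assumes "finite Z" "w \<notin> Z"
  shows "((\<lambda>w. \<Prod>\<rho>\<in>Z. (w - \<rho>) ^ m \<rho>) has_field_derivative
           (\<Prod>\<rho>\<in>Z. (w - \<rho>) ^ m \<rho>) * (\<Sum>\<rho>\<in>Z. of_nat (m \<rho>) / (w - \<rho>))) (at w)"
proof -
  have "((\<lambda>w. \<Prod>\<rho>\<in>Z. (w - \<rho>) ^ m \<rho>) has_field_derivative (\<Prod>\<rho>\<in>Z. (w - \<rho>) ^ m \<rho>) *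
    (\<Sum>\<rho>\<in>Z. of_nat (m \<rho>) * (w - \<rho>) ^ (m \<rho> - 1) / (w - \<rho>) ^ m \<rho>)) (at w)"
  proof (rule has_field_derivative_prod'[where f = "\<lambda>\<rho> w. (w - \<rho>) ^ m \<rho>"])
    show "(w - \<rho>) ^ m \<rho> \<noteq> 0" if "\<rho> \<in> Z" for \<rho> using that assms by auto
    show "((\<lambda>w. (w - \<rho>) ^ m \<rho>) has_field_derivative of_nat (m \<rho>) * (w - \<rho>) ^ (m \<rho> - 1)) (at w)"
      for \<rho>
      by (rule DERIV_cong[OF DERIV_power[OF DERIV_diff[OF DERIV_ident DERIV_const]]]) simp
  qed
  moreover have "of_nat (m \<rho>) * (w - \<rho>) ^ (m \<rho> - 1) / (w - \<rho>) ^ m \<rho> = of_nat (m \<rho>) / (w - \<rho>)"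
    if "\<rho> \<in> Z" for \<rho>
  proof (cases "m \<rho>")
    case (Suc k)
    moreover have "w - \<rho> \<noteq> 0" using that assms by auto
    ultimately show ?thesis by simp
  qed simp
  ultimately show ?thesis by simp
qed

lemma derivs_of_linear_factor:
  assumes g: "g holomorphic_on UNIV" and f: "\<And>w. f w = (w - a) * g w"
  shows "deriv f a = g a" "deriv (deriv f) a = 2 * deriv g a"
proof -
  have dg: "(g has_field_derivative deriv g w) (at w)" for w
    using g holomorphic_derivI by blast
  have ddg: "(deriv g has_field_derivative deriv (deriv g) w) (at w)" for w
    using g by (metis holomorphic_deriv holomorphic_derivI UNIV_I open_UNIV)
  have "(f has_field_derivative g w + (w - a) * deriv g w) (at w)" for w
    unfolding f[abs_def] by (auto intro!: derivative_eq_intros dg)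
  then have df: "deriv f = (\<lambda>w. g w + (w - a) * deriv g w)"
    by (intro ext DERIV_imp_deriv)
  then show "deriv f a = g a" by simp
  show "deriv (deriv f) a = 2 * deriv g a"
    unfolding df by (intro DERIV_imp_deriv) (auto intro!: derivative_eq_intros dg ddg)
qed

lemma logderiv_of_product:
  assumes Q: "Q holomorphic_on UNIV" and "Q w \<noteq> 0" "finite Z" "w \<notin> Z"
    and h: "\<And>w. h w = Q w * (\<Prod>\<rho>\<in>Z. (w - \<rho>) ^ m \<rho>)"
  shows "deriv h w / h w = deriv Q w / Q w + (\<Sum>\<rho>\<in>Z. of_nat (m \<rho>) / (w - \<rho>))" "h w \<noteq> 0"
proof -
  have dQ: "(Q has_field_derivative deriv Q w) (at w)"
    using Q holomorphic_derivI by blast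
  define P where "P = (\<Prod>\<rho>\<in>Z. (w - \<rho>) ^ m \<rho>)"
  have P: "P \<noteq> 0" using assms by (auto simp: P_def)
  have "(h has_field_derivative deriv Q w * P + P * (\<Sum>\<rho>\<in>Z. of_nat (m \<rho>) / (w - \<rho>)) * Q w) (at w)"
    unfolding h[abs_def] P_def
    by (rule DERIV_mult[OF dQ zero_product_has_derivative]) (use assms in auto)
  then have "deriv h w = deriv Q w * P + P * (\<Sum>\<rho>\<in>Z. of_nat (m \<rho>) / (w - \<rho>)) * Q w"
    by (rule DERIV_imp_deriv)
  moreover have "h w = Q w * P" by (simp add: h P_def)
  ultimately show "deriv h w / h w = deriv Q w / Q w + (\<Sum>\<rho>\<in>Z. of_nat (m \<rho>) / (w - \<rho>))" "h w \<noteq> 0"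
    using P \<open>Q w \<noteq> 0\<close> by (auto simp: field_simps)
qed

lemma entire_zorder_nonneg:
  assumes "f holomorphic_on UNIV" "f b \<noteq> 0"
  shows "0 \<le> zorder f a"
  using zorder_exist_zero[OF assms(1) open_UNIV connected_UNIV UNIV_I bexI[of _ b], of a] assms(2)
  by (auto split: if_splits)

lemma finite_zeros_in_ball:
  assumes "f holomorphic_on UNIV" "f c \<noteq> 0"
  shows "finite {w \<in> ball b R. f w = 0}"
proof (cases "f constant_on UNIV")
  case True
  then have "{w \<in> ball b R. f w = 0} = {}" using assms(2) by (auto simp: constant_on_def)
  then show ?thesis by (simp only: finite.emptyI)
next
  case False
  have "finite {w \<in> cball b R. f w = 0}"
    by (rule holomorphic_compact_finite_zeros[OF assms(1)]) (use False in auto)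
  then show ?thesis by (rule rev_finite_subset) auto
qed

text \<open>
  Write \<open>f = Q P\<close> with \<open>P\<close> the product over the zeros in the ball.  At \<open>c\<close> the logarithmic derivatives of
  \<open>P\<close> and \<open>Q\<close> add up to that of \<open>f\<close>; at the simple zero \<open>a\<close> the same holds for \<open>f / (w - a)\<close>, whose logarithmic
  derivative there is \<open>f'' / (2 f')\<close>.  The error is therefore the difference of the logarithmic derivatives of
  \<open>Q\<close> at \<open>a\<close> and \<open>c\<close>.
\<close>

lemma partial_fraction_error:
  assumes hol: "f holomorphic_on UNIV" and fc: "f c \<noteq> 0"
    and a: "f a = 0" "zorder f a = 1" and R: "0 < R" and ac: "dist c a < R / 4" and A: "0 \<le> A"
    and bd: "\<And>w. dist c w = 2 * R \<Longrightarrow> norm (f w) \<le> exp A * norm (f c)"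
  defines "Z \<equiv> {w \<in> ball c R. f w = 0}"
  shows "norm (((\<Sum>\<rho>\<in>Z - {a}. of_int (zorder f \<rho>) / (a - \<rho>)) - (\<Sum>\<rho>\<in>Z. of_int (zorder f \<rho>) / (c - \<rho>)))
          - (deriv (deriv f) a / (2 * deriv f a) - deriv f c / f c))
         \<le> 64 * (A + 1) * norm (a - c) / R\<^sup>2"
proof -
  have fin: "finite Z" unfolding Z_def using finite_zeros_in_ball[OF hol fc] .
  have ord: "of_int (zorder f \<rho>) = (of_nat (nat (zorder f \<rho>)) :: complex)" for \<rho>
    by (rule of_nat_nat[symmetric, OF entire_zorder_nonneg[OF hol fc]])
  obtain Q where Q: "Q holomorphic_on UNIV" "\<And>w. w \<in> ball c R \<Longrightarrow> Q w \<noteq> 0"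
    "\<And>w. f w = Q w * (\<Prod>\<rho>\<in>Z. (w - \<rho>) ^ nat (zorder f \<rho>))"
    using factor_out_zeros_in_ball[OF hol Z_def[THEN meta_eq_to_obj_eq] fin] fc by metis
  have aZ: "a \<in> Z" and cZ: "c \<notin> Z" using a ac R fc by (auto simp: Z_def)
  define g where "g = (\<lambda>w. Q w * (\<Prod>\<rho>\<in>Z - {a}. (w - \<rho>) ^ nat (zorder f \<rho>)))"
  have g: "g holomorphic_on UNIV" unfolding g_def by (intro holomorphic_intros Q)
  have fg: "f w = (w - a) * g w" for w
    using Q(3)[of w] unfolding prod.remove[OF fin aZ] a(2) by (simp add: g_def)
  have aR: "a \<in> ball c R" using ac R by auto
  have 1: "deriv g a / g a = deriv Q a / Q a + (\<Sum>\<rho>\<in>Z-{a}. of_nat (nat (zorder f \<rho>)) / (a - \<rho>))"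
    "g a \<noteq> 0"
    using logderiv_of_product[OF Q(1) Q(2)[OF aR], of "Z - {a}" g "\<lambda>\<rho>. nat (zorder f \<rho>)"] fin
    unfolding g_def by blast+
  have 2: "deriv f c / f c = deriv Q c / Q c + (\<Sum>\<rho>\<in>Z. of_nat (nat (zorder f \<rho>)) / (c - \<rho>))"
    using logderiv_of_product[OF Q(1) Q(2) fin cZ, of f "\<lambda>\<rho>. nat (zorder f \<rho>)"] Q(3) R
    by (meson centre_in_ball)
  have "norm (deriv Q a / Q a - deriv Q c / Q c) \<le> 64 * (A + 1) * norm (a - c) / R\<^sup>2"
  proof (rule zero_free_part_logderiv[OF Q(1,2) R _ A ac])
    fix w assume "w \<in> ball c R"
    then show "norm (Q w) \<le> exp A * norm (Q c)"
      using zero_free_part_bound[OF Q(1) _ R _ fin cZ Q(3) bd, of w] Q(2)[of c] R Z_def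
      by (simp add: subset_iff)
  qed
  moreover have sums: "(\<Sum>\<rho>\<in>Z - {a}. of_int (zorder f \<rho>) / (a - \<rho>)) = (\<Sum>\<rho>\<in>Z-{a}. of_nat (nat (zorder f \<rho>)) / (a - \<rho>))"
    "(\<Sum>\<rho>\<in>Z. of_int (zorder f \<rho>) / (c - \<rho>)) = (\<Sum>\<rho>\<in>Z. of_nat (nat (zorder f \<rho>)) / (c - \<rho>))"
    by (rule sum.cong[OF refl], subst ord, auto)+
  moreover have "deriv (deriv f) a / (2 * deriv f a) = deriv g a / g a"
    using derivs_of_linear_factor[OF g fg] by simp
  ultimately have le: "norm (deriv Q a / Q a - deriv Q c / Q c) \<le> 64 * (A + 1) * norm (a - c) / R\<^sup>2"
    and dd: "deriv (deriv f) a / (2 * deriv f a) = deriv g a / g a" by auto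
  show "norm (((\<Sum>\<rho>\<in>Z - {a}. of_int (zorder f \<rho>) / (a - \<rho>)) - (\<Sum>\<rho>\<in>Z. of_int (zorder f \<rho>) / (c - \<rho>)))
          - (deriv (deriv f) a / (2 * deriv f a) - deriv f c / f c))
         \<le> 64 * (A + 1) * norm (a - c) / R\<^sup>2"
    unfolding sums dd 1(1) 2 using le by (subst norm_minus_commute) (simp add: algebra_simps)
qed

definition subquadratic_growth :: "(complex \<Rightarrow> complex) \<Rightarrow> bool" where
  "subquadratic_growth f \<longleftrightarrow> (\<forall>\<epsilon>>0. \<exists>C. \<forall>w. norm (f w) \<le> C * exp (\<epsilon> * (norm w)\<^sup>2))"

text \<open>
  For \<open>R\<close> large, growth with constant \<open>\<epsilon>\<close> gives \<open>A = 9 \<epsilon> R\<^sup>2 + O(1)\<close> in \<open>partial_fraction_error\<close>, so the error is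
  at most \<open>576 \<epsilon> |a - c| + o(1)\<close>.  The zeros are summed over growing discs because neither sum need converge
  by itself.
\<close>

proposition partial_fractions_at_simple_zero:
  assumes hol: "f holomorphic_on UNIV" and growth: "subquadratic_growth f" and fc: "f c \<noteq> 0"
    and a: "f a = 0" "zorder f a = 1"
  defines "Z \<equiv> \<lambda>R. {w \<in> ball c R. f w = 0}"
  shows "((\<lambda>R. (\<Sum>\<rho>\<in>Z R - {a}. of_int (zorder f \<rho>) / (a - \<rho>))
               - (\<Sum>\<rho>\<in>Z R. of_int (zorder f \<rho>) / (c - \<rho>)))
          \<longlongrightarrow> deriv (deriv f) a / (2 * deriv f a) - deriv f c / f c) at_top"
proof (rule tendstoI)
  fix e :: real assume e: "0 < e"
  have ac: "a \<noteq> c" using a fc by auto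
  define d where "d = norm (a - c)"
  have d: "d > 0" using ac by (simp add: d_def)
  \<comment> \<open>chosen so that \<open>64 * 9 * \<epsilon> * d = e / 2\<close>\<close>
  define \<epsilon> where "\<epsilon> = e / (1152 * d)"
  have \<epsilon>: "\<epsilon> > 0" using d e by (simp add: \<epsilon>_def)
  obtain C where C: "\<And>w. norm (f w) \<le> C * exp (\<epsilon> * (norm w)\<^sup>2)"
    using growth \<epsilon> by (auto simp: subquadratic_growth_def)
  have "0 < C * exp (\<epsilon> * (norm c)\<^sup>2)" using C[of c] fc by (meson zero_less_norm_iff less_le_trans)
  then have C0: "C > 0" by (simp add: zero_less_mult_iff)
  define B where "B = \<bar>ln (C / norm (f c))\<bar>"
  have "((\<lambda>R. 64 * (B + 1) * d / R\<^sup>2) \<longlongrightarrow> 0) at_top" by real_asymp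
  then have "\<forall>\<^sub>F R in at_top. 64 * (B + 1) * d / R\<^sup>2 < e / 2"
    by (rule order_tendstoD) (use e in simp)
  moreover have "\<forall>\<^sub>F R in at_top. norm c + 4 * d + 1 < R" by (rule eventually_gt_at_top)
  ultimately show "\<forall>\<^sub>F R in at_top. dist ((\<Sum>\<rho>\<in>Z R - {a}. of_int (zorder f \<rho>) / (a - \<rho>))
               - (\<Sum>\<rho>\<in>Z R. of_int (zorder f \<rho>) / (c - \<rho>)))
           (deriv (deriv f) a / (2 * deriv f a) - deriv f c / f c) < e"
  proof eventually_elim
    case (elim R)
    have R0: "0 < R" using elim(2) d norm_ge_zero[of c] by linarith
    \<comment> \<open>on the circle of radius \<open>2R\<close> around \<open>c\<close> one has \<open>|w| \<le> 3R\<close>\<close>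
    define A where "A = 9 * \<epsilon> * R\<^sup>2 + B"
    have "dist ((\<Sum>\<rho>\<in>Z R - {a}. of_int (zorder f \<rho>) / (a - \<rho>))
               - (\<Sum>\<rho>\<in>Z R. of_int (zorder f \<rho>) / (c - \<rho>)))
           (deriv (deriv f) a / (2 * deriv f a) - deriv f c / f c) \<le> 64 * (A + 1) * norm (a - c) / R\<^sup>2"
      unfolding Z_def dist_norm
    proof (rule partial_fraction_error[OF hol fc a R0])
      show "dist c a < R / 4" 
        using elim(2) norm_ge_zero[of c] unfolding dist_norm norm_minus_commute[of c a] d_def by linarith
      show "0 \<le> A" using \<epsilon> by (simp add: A_def B_def)
      fix w assume w: "dist c w = 2 * R"
      have "norm w \<le> norm c + norm (w - c)" using norm_triangle_sub by blast
      also have "norm (w - c) = 2 * R" using w by (simp add: dist_norm norm_minus_commute)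
      finally have "norm w \<le> 3 * R" using elim(2) d by linarith
      then have "(norm w)\<^sup>2 \<le> (3 * R)\<^sup>2" by (intro power_mono) auto
      then have "\<epsilon> * (norm w)\<^sup>2 \<le> 9 * \<epsilon> * R\<^sup>2" using \<epsilon> by (simp add: power_mult_distrib)
      then have "norm (f w) \<le> C * exp (9 * \<epsilon> * R\<^sup>2)"
        using C[of w] C0 by (meson exp_le_cancel_iff mult_le_cancel_left_pos order_trans)
      also have "C = exp (ln (C / norm (f c))) * norm (f c)" using C0 fc by simp
      also have "\<dots> \<le> exp B * norm (f c)" by (intro mult_right_mono) (auto simp: B_def)
      finally show "norm (f w) \<le> exp A * norm (f c)" 
        by (simp add: A_def exp_add mult_ac)
    qed
    also have "\<dots> = 576 * \<epsilon> * d + 64 * (B + 1) * d / R\<^sup>2"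
      using R0 by (simp add: A_def d_def field_simps)
    also have "576 * \<epsilon> * d = e / 2" using d by (simp add: \<epsilon>_def field_simps)
    finally show ?case using elim(1) by linarith
  qed
qed

section \<open>Highest zeros of entire functions that are real on the real axis\<close>

lemma simple_zero_deriv_nonzero:
  assumes hol: "f holomorphic_on UNIV" and nz: "f b \<noteq> 0" and a: "zorder f a = 1"
  shows "deriv f a \<noteq> 0"
proof -
  obtain r where r: "r > 0" "zor_poly f a holomorphic_on cball a r"
    "\<And>w. w \<in> cball a r \<Longrightarrow> f w = zor_poly f a w * (w - a) \<and> zor_poly f a w \<noteq> 0"
    using zorder_exist_zero[OF hol open_UNIV connected_UNIV UNIV_I bexI[of _ b], of a] nz a by auto
  have "zor_poly f a holomorphic_on ball a r" using r(2) by (rule holomorphic_on_subset) auto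
  then have "(zor_poly f a has_field_derivative deriv (zor_poly f a) a) (at a)"
    using r(1) by (auto intro: holomorphic_derivI)
  then have "((\<lambda>w. zor_poly f a w * (w - a)) has_field_derivative zor_poly f a a) (at a)"
    by (auto intro!: derivative_eq_intros)
  then have "(f has_field_derivative zor_poly f a a) (at a)"
    by (rule has_field_derivative_transform_within_open[of _ _ _ "ball a r"]) (use r in auto)
  then show ?thesis using r(1,3) by (auto simp: DERIV_imp_deriv)
qed

lemma zorder_cnj:
  assumes hol: "f holomorphic_on UNIV" and real: "\<And>w. f (cnj w) = cnj (f w)" and nz: "f b \<noteq> 0"
  shows "zorder f (cnj a) = zorder f a"
proof -
  define g n where "g = zor_poly f a" and "n = nat (zorder f a)"
  have "(if f a = 0 then zorder f a > 0 else zorder f a = 0) \<and>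
    (\<exists>r. r > 0 \<and> cball a r \<subseteq> UNIV \<and> g holomorphic_on cball a r \<and>
      (\<forall>w\<in>cball a r. f w = g w * (w - a) ^ n \<and> g w \<noteq> 0))"
    unfolding g_def n_def using nz
    by (intro zorder_exist_zero[OF hol open_UNIV connected_UNIV UNIV_I]) auto
  then obtain r where r: "r > 0" "g holomorphic_on cball a r"
    "\<And>w. w \<in> cball a r \<Longrightarrow> f w = g w * (w - a) ^ n" "\<And>w. w \<in> cball a r \<Longrightarrow> g w \<noteq> 0"
    and "zorder f a \<ge> 0" by (metis less_imp_le order_refl)
  then have n: "int n = zorder f a" by (simp add: n_def)
  have "zorder f (cnj a) = int n"
  proof (rule zorder_eqI)
    show "open (cnj -` ball a r)" by (intro continuous_open_vimage continuous_intros) auto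
    show "cnj a \<in> cnj -` ball a r" using r by simp
    have "cnj ` (cnj -` ball a r) \<subseteq> ball a r" by auto
    moreover have "cnj ` (cnj -` ball a r) = ball a r"
      by (auto intro!: image_eqI[of _ cnj "cnj _"])
    ultimately show "(\<lambda>w. cnj (g (cnj w))) holomorphic_on cnj -` ball a r"
      using holomorphic_on_compose_cnj_cnj[of g "cnj -` ball a r"] r(2)
        holomorphic_on_subset[OF r(2) ball_subset_cball] \<open>open (cnj -` ball a r)\<close>
      by (simp add: o_def)
    show "cnj (g (cnj (cnj a))) \<noteq> 0" using r by simp
    fix w assume "w \<in> cnj -` ball a r"
    then have "f (cnj w) = g (cnj w) * (cnj w - a) ^ n" using r(3)[of "cnj w"] by simp
    then have "cnj (f w) = g (cnj w) * (cnj w - a) ^ n" by (simp add: real)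
    then have "f w = cnj (g (cnj w) * (cnj w - a) ^ n)" by (metis complex_cnj_cnj)
    then show "f w = cnj (g (cnj w)) * (w - cnj a) powi int n" by simp
  qed
  then show ?thesis using n by simp
qed

lemma logderiv_real_on_real_axis:
  assumes hol: "f holomorphic_on UNIV" and real: "\<And>w. f (cnj w) = cnj (f w)"
  shows "Im (deriv f (of_real x) / f (of_real x)) = 0"
proof -
  have "(f has_field_derivative deriv f (of_real x)) (at (of_real x))"
    using hol holomorphic_derivI by blast
  then have "(cnj \<circ> f \<circ> cnj has_field_derivative cnj (deriv f (of_real x))) (at (of_real x))"
    using has_field_derivative_cnj_cnj[of f _ "of_real x"] by simp
  moreover have "cnj \<circ> f \<circ> cnj = f" by (auto simp: real)
  ultimately have "deriv f (of_real x) = cnj (deriv f (of_real x))" by (metis DERIV_imp_deriv)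
  moreover have "f (of_real x) = cnj (f (of_real x))" using real[of "of_real x"] unfolding complex_cnj_complex_of_real .
  ultimately have "cnj (deriv f (of_real x) / f (of_real x)) = deriv f (of_real x) / f (of_real x)"
    unfolding complex_cnj_divide by argo
  then show ?thesis by (metis complex_cnj_cancel_iff Reals_cnj_iff complex_is_Real_iff)
qed

lemma real_nonzero_point:
  assumes hol: "f holomorphic_on UNIV" and nz: "f b \<noteq> 0"
  obtains x :: real where "f (of_real x) \<noteq> 0"
proof (rule ccontr)
  assume "\<not> thesis"
  then have "f (of_real x) = 0" for x using that by blast
  then have "of_real ` {0..1::real} \<subseteq> {w \<in> ball 0 2. f w = 0}" by auto
  then have "finite ((of_real :: real \<Rightarrow> complex) ` {0..1})"
    using finite_zeros_in_ball[OF hol nz] finite_subset by blast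
  then show False by (subst (asm) finite_image_iff) (auto simp: inj_on_def infinite_Icc)
qed

text \<open>
  Used for every cancellation between a zero and its conjugate.
\<close>

lemma sum_odd_under_cnj:
  fixes g :: "complex \<Rightarrow> real"
  assumes "cnj ` Z = Z" "\<And>\<rho>. \<rho> \<in> Z \<Longrightarrow> g (cnj \<rho>) = - g \<rho>"
  shows "sum g Z = 0"
proof -
  have "sum g Z = sum g (cnj ` Z)" using assms by simp
  also have "\<dots> = (\<Sum>\<rho>\<in>Z. g (cnj \<rho>))" by (subst sum.reindex) (auto simp: inj_on_def)
  also have "\<dots> = - sum g Z" using assms by (simp add: sum_negf)
  finally show ?thesis by simp
qed

text \<open>
  The vertical distance \<open>Im a - Im \<rho>\<close> lies between \<open>0\<close> and \<open>2 Im a\<close>; replacing its square in the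
  denominator by the largest possible value makes the fraction smaller.
\<close>

lemma Im_reciprocal_le:
  assumes "0 < Im a" "\<bar>Im \<rho>\<bar> \<le> Im a" "\<rho> \<noteq> a"
  shows "Im (1 / (a - \<rho>)) \<le> - (Im a - Im \<rho>) / ((Re \<rho> - Re a)\<^sup>2 + 4 * (Im a)\<^sup>2)"
proof -
  have "a - \<rho> \<noteq> 0" using assms by auto
  then have pos: "0 < (Re \<rho> - Re a)\<^sup>2 + (Im a - Im \<rho>)\<^sup>2"
    by (auto simp: complex_eq_iff sum_power2_gt_zero_iff)
  have "(Im a - Im \<rho>)\<^sup>2 \<le> (2 * Im a)\<^sup>2" using assms by (intro power_mono) auto
  then have le: "(Re \<rho> - Re a)\<^sup>2 + (Im a - Im \<rho>)\<^sup>2 \<le> (Re \<rho> - Re a)\<^sup>2 + 4 * (Im a)\<^sup>2"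
    by (simp add: power_mult_distrib)
  have "(Im a - Im \<rho>) / ((Re \<rho> - Re a)\<^sup>2 + 4 * (Im a)\<^sup>2)
        \<le> (Im a - Im \<rho>) / ((Re \<rho> - Re a)\<^sup>2 + (Im a - Im \<rho>)\<^sup>2)"
    using le pos assms by (intro divide_left_mono) auto
  moreover have "Im (1 / (a - \<rho>)) = - ((Im a - Im \<rho>) / ((Re \<rho> - Re a)\<^sup>2 + (Im a - Im \<rho>)\<^sup>2))"
    unfolding minus_divide_left by (simp add: Im_divide power2_commute)
  ultimately show ?thesis by (simp only: minus_divide_left[symmetric] neg_le_iff_le)
qed

text \<open>
  Among the zeros in a disc around a real point \<open>x\<close>, which are symmetric under conjugation, the subtracted sum is
  real, \<open>cnj a\<close> contributes \<open>- 1 / (2 Im a)\<close>, and the others are bounded termwise by \<open>Im_reciprocal_le\<close>.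
  All terms of the resulting sum are nonnegative, so it may be cut down to any finite set \<open>F\<close> before
  the radius tends to infinity.
\<close>

proposition Im_deriv_ratio_at_highest_zero:
  assumes hol: "f holomorphic_on UNIV" and growth: "subquadratic_growth f"
    and real: "\<And>w. f (cnj w) = cnj (f w)"
    and a: "f a = 0" "zorder f a = 1" and y: "0 < Im a"
    and highest: "\<And>\<rho>. f \<rho> = 0 \<Longrightarrow> \<bar>Im \<rho>\<bar> \<le> Im a"
    and F: "finite F" "F \<subseteq> {\<rho>. f \<rho> = 0} - {a, cnj a}"
  shows "Im (deriv (deriv f) a / deriv f a)
          \<le> - 1 / Im a - 2 * Im a * (\<Sum>\<rho>\<in>F. of_int (zorder f \<rho>) / ((Re \<rho> - Re a)\<^sup>2 + 4 * (Im a)\<^sup>2))"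
proof -
  \<comment> \<open>a point above the highest zero shows that \<open>f\<close> is not identically zero\<close>
  have nz: "f (a + \<i>) \<noteq> 0" using highest[of "a + \<i>"] y by auto
  obtain x :: real where fx: "f (of_real x) \<noteq> 0" using real_nonzero_point[OF hol nz] .
  define Z where "Z = (\<lambda>R. {w \<in> ball (complex_of_real x) R. f w = 0})"
  define G where "G = (\<lambda>\<rho>. of_int (zorder f \<rho>) / ((Re \<rho> - Re a)\<^sup>2 + 4 * (Im a)\<^sup>2))"
  have ord0: "zorder f \<rho> \<ge> 0" for \<rho>
    using entire_zorder_nonneg[OF hol nz] .
  note ord_cnj = zorder_cnj[OF hol real nz]
  have fcnj: "f (cnj \<rho>) = 0 \<longleftrightarrow> f \<rho> = 0" for \<rho> by (simp add: real)
  have "dist (complex_of_real x) (cnj \<rho>) = dist (of_real x) \<rho>" for \<rho>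
    by (metis complex_cnj_complex_of_real complex_cnj_diff complex_mod_cnj dist_norm)
  then have Zc: "cnj \<rho> \<in> Z R \<longleftrightarrow> \<rho> \<in> Z R" for \<rho> R by (simp add: Z_def fcnj)
  have G0: "G \<rho> \<ge> 0" for \<rho> using ord0 by (simp add: G_def)
  have bound: "Im ((\<Sum>\<rho>\<in>Z R - {a}. of_int (zorder f \<rho>) / (a - \<rho>))
               - (\<Sum>\<rho>\<in>Z R. of_int (zorder f \<rho>) / (of_real x - \<rho>)))
            \<le> - 1 / (2 * Im a) - Im a * sum G F"
    if FZ: "F \<subseteq> Z R" and aZ: "a \<in> Z R" for R
  proof -
    have fin: "finite (Z R)" unfolding Z_def using finite_zeros_in_ball[OF hol fx] .
    define Z' where "Z' = Z R - {a, cnj a}"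
    have fin': "finite Z'" using fin by (simp add: Z'_def)
    have cnj_image: "cnj ` A = A" if "\<And>\<rho>. \<rho> \<in> A \<Longrightarrow> cnj \<rho> \<in> A" for A
      using that by (force intro: image_eqI[of _ cnj "cnj _"])
    have Z'c: "cnj ` Z' = Z'" by (rule cnj_image) (auto simp: Z'_def Zc)
    have ca: "cnj a \<in> Z R - {a}" using aZ Zc y by (auto simp: complex_eq_iff)
    have "(\<Sum>\<rho>\<in>Z R. Im (of_int (zorder f \<rho>) / (of_real x - \<rho>))) = 0"
    proof (rule sum_odd_under_cnj[OF cnj_image])
      fix \<rho>
      have "of_int (zorder f (cnj \<rho>)) / (of_real x - cnj \<rho>) = cnj (of_int (zorder f \<rho>) / (of_real x - \<rho>))"
        by (simp add: ord_cnj)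
      then show "Im (of_int (zorder f (cnj \<rho>)) / (of_real x - cnj \<rho>)) = - Im (of_int (zorder f \<rho>) / (of_real x - \<rho>))"
        by (simp only: cnj.sel)
    qed (simp add: Zc)
    moreover have "Z R - {a} = insert (cnj a) Z'" using ca by (auto simp: Z'_def)
    moreover have "Im (of_int (zorder f (cnj a)) / (a - cnj a)) = - 1 / (2 * Im a)"
      using y by (simp add: ord_cnj a Im_divide power2_eq_square)
    moreover have "cnj a \<notin> Z'" by (simp add: Z'_def)
    ultimately have "Im ((\<Sum>\<rho>\<in>Z R - {a}. of_int (zorder f \<rho>) / (a - \<rho>))
               - (\<Sum>\<rho>\<in>Z R. of_int (zorder f \<rho>) / (of_real x - \<rho>)))
         = - 1 / (2 * Im a) + (\<Sum>\<rho>\<in>Z'. Im (of_int (zorder f \<rho>) / (a - \<rho>)))"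
      using fin' by (simp add: Im_sum)
    also have "(\<Sum>\<rho>\<in>Z'. Im (of_int (zorder f \<rho>) / (a - \<rho>))) \<le> (\<Sum>\<rho>\<in>Z'. Im \<rho> * G \<rho> - Im a * G \<rho>)"
    proof (rule sum_mono)
      fix \<rho> assume \<rho>: "\<rho> \<in> Z'"
      have "Im (of_int k * w) = of_int k * Im w" for k w by simp
      from this[of "zorder f \<rho>" "1 / (a - \<rho>)"]
      have "Im (of_int (zorder f \<rho>) / (a - \<rho>)) = of_int (zorder f \<rho>) * Im (1 / (a - \<rho>))"
        by (simp only: times_divide_eq_right mult_1_right)
      also have "\<dots> \<le> of_int (zorder f \<rho>) * (- (Im a - Im \<rho>) / ((Re \<rho> - Re a)\<^sup>2 + 4 * (Im a)\<^sup>2))"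
        using \<rho> ord0 highest by (intro mult_left_mono Im_reciprocal_le y) (auto simp: Z'_def Z_def)
      also have "\<dots> = Im \<rho> * G \<rho> - Im a * G \<rho>" by (simp add: G_def diff_divide_distrib algebra_simps)
      finally show "Im (of_int (zorder f \<rho>) / (a - \<rho>)) \<le> Im \<rho> * G \<rho> - Im a * G \<rho>" .
    qed
    also have "\<dots> = - (Im a * sum G Z')"
    proof -
      have "(\<Sum>\<rho>\<in>Z'. Im \<rho> * G \<rho>) = 0"
        by (rule sum_odd_under_cnj[OF Z'c]) (simp add: G_def ord_cnj)
      then show ?thesis by (simp add: sum_subtractf sum_distrib_left)
    qed
    finally have "Im ((\<Sum>\<rho>\<in>Z R - {a}. of_int (zorder f \<rho>) / (a - \<rho>))
               - (\<Sum>\<rho>\<in>Z R. of_int (zorder f \<rho>) / (of_real x - \<rho>)))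
         \<le> - 1 / (2 * Im a) - Im a * sum G Z'" by simp
    moreover have "Im a * sum G F \<le> Im a * sum G Z'"
      using y F FZ G0 fin' by (intro mult_left_mono sum_mono2) (auto simp: Z'_def)
    ultimately show ?thesis by linarith
  qed
  have lim: "((\<lambda>R. Im ((\<Sum>\<rho>\<in>Z R - {a}. of_int (zorder f \<rho>) / (a - \<rho>))
               - (\<Sum>\<rho>\<in>Z R. of_int (zorder f \<rho>) / (of_real x - \<rho>))))
          \<longlongrightarrow> Im (deriv (deriv f) a / (2 * deriv f a) - deriv f (of_real x) / f (of_real x))) at_top"
    unfolding Z_def by (intro tendsto_Im partial_fractions_at_simple_zero[OF hol growth fx a])
  have "\<forall>\<^sub>F R in at_top. insert a F \<subseteq> ball (of_real x) R"
  proof -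
    have "bounded (insert a F)" using F by (simp add: finite_imp_bounded)
    then obtain R where "insert a F \<subseteq> ball (of_real x) R"
      using bounded_subset_ballD by blast
    then show ?thesis
      by (intro eventually_mono[OF eventually_ge_at_top[of R]]) (meson order_trans subset_ball)
  qed
  then have "\<forall>\<^sub>F R in at_top. Im ((\<Sum>\<rho>\<in>Z R - {a}. of_int (zorder f \<rho>) / (a - \<rho>))
               - (\<Sum>\<rho>\<in>Z R. of_int (zorder f \<rho>) / (of_real x - \<rho>))) \<le> - 1 / (2 * Im a) - Im a * sum G F"
  proof eventually_elim
    case (elim R)
    then have "F \<subseteq> Z R" "a \<in> Z R" using F a(1) unfolding Z_def by auto
    then show ?case by (rule bound)
  qed
  with lim have "Im (deriv (deriv f) a / (2 * deriv f a) - deriv f (of_real x) / f (of_real x))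
      \<le> - 1 / (2 * Im a) - Im a * sum G F"
    by (rule tendsto_upperbound) simp
  moreover have "Im (deriv (deriv f) a / (2 * deriv f a)) = Im (deriv (deriv f) a / deriv f a) / 2"
    using Im_divide_of_real[of "deriv (deriv f) a / deriv f a" 2] by (simp add: mult.commute)
  ultimately show ?thesis
    using logderiv_real_on_real_axis[OF hol real, of x] y unfolding G_def[symmetric]
    by (simp add: field_simps)
qed

section \<open>Decay of the kernel and its exponential integrals\<close>

lemma power_le_fact_times_exp:
  fixes x :: real
  assumes "0 \<le> x"
  shows "x ^ n \<le> fact n * exp x"
proof -
  have "(\<lambda>n. x ^ n / fact n) sums exp x"
    using exp_converges[of x] by (simp add: divide_inverse mult.commute)
  then have "(\<Sum>i\<in>{n}. x ^ i / fact i) \<le> exp x"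
    using assms sum_le_suminf[of "\<lambda>n. x ^ n / fact n" "{n}"] by (simp add: sums_iff)
  then show ?thesis by (simp add: divide_simps mult.commute)
qed

text \<open>
  With \<open>v = n\<^sup>2 e\<^sup>4\<^sup>u\<close> the polynomial factor of the \<open>n\<close>-th term is at most a multiple of
  \<open>v\<^sup>3 / n\<^sup>2 \<le> 6 e\<^sup>v / n\<^sup>2\<close>, which half of the exponent absorbs, as \<open>\<pi> \<ge> 2\<close>.  The other half leaves
  \<open>e\<^sup>-\<^sup>v\<close> with \<open>v \<ge> e\<^sup>4\<^sup>u \<ge> u\<^sup>3\<close>.  The true decay is doubly exponential, but a cubic exponent
  already beats every quadratic one.
\<close>

lemma Phi_super_gaussian_decay:
  obtains C where "0 \<le> C" "\<And>u. 0 \<le> u \<Longrightarrow> \<bar>Phi u\<bar> \<le> C * exp (- (u ^ 3))"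
proof
  define D where "D = 6 * (2 * pi\<^sup>2 + 3 * pi)"
  define t where "t = (\<lambda>u n. (2 * pi^2 * real (Suc n)^4 * exp (9*u) - 3 * pi * real (Suc n)^2 * exp (5*u))
                 * exp (- pi * real (Suc n)^2 * exp (4*u)))"
  show "0 \<le> D * (pi\<^sup>2 / 6)" by (simp add: D_def)
  fix u :: real assume u: "0 \<le> u"
  have term_le: "norm (t u n) \<le> D * exp (- (u ^ 3)) * (1 / (real n + 1)\<^sup>2)" for n
  proof -
    define N where "N = real (Suc n)"
    have N: "N \<ge> 1" by (simp add: N_def)
    define v where "v = N\<^sup>2 * exp (4 * u)"
    have N2: "N\<^sup>2 \<ge> 1" using N by (simp add: one_le_power)
    have v: "v \<ge> exp (4 * u)" unfolding v_def using mult_right_mono[OF N2, of "exp (4*u)"] by simp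
    have "(4 * u) ^ 3 \<le> 6 * exp (4 * u)"
      using power_le_fact_times_exp[of "4 * u" 3] u by (simp add: fact_numeral)
    then have "64 * u ^ 3 \<le> 6 * exp (4 * u)" by (simp add: power_mult_distrib)
    then have uv: "u ^ 3 \<le> v" using v zero_le_power[OF u, of 3] by linarith
    have "v > 0" using v by (meson exp_gt_zero less_le_trans)
    have "N ^ 4 * exp (9 * u) * N\<^sup>2 \<le> N ^ 4 * exp (12 * u) * N\<^sup>2"
      using u N by (intro mult_right_mono mult_left_mono) auto
    also have "\<dots> = v ^ 3"
      by (simp add: v_def power_mult_distrib exp_of_nat_mult[symmetric] flip: power_mult power_add)
    also have "\<dots> \<le> 6 * exp v"
      using power_le_fact_times_exp[of v 3] \<open>v > 0\<close> by (simp add: fact_numeral)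
    finally have main: "N ^ 4 * exp (9 * u) \<le> 6 * exp v / N\<^sup>2"
      using N by (simp add: field_simps)
    have "N\<^sup>2 * exp (5 * u) \<le> N ^ 4 * exp (9 * u)"
      using u N by (intro mult_mono power_increasing) auto
    then have "\<bar>2 * pi\<^sup>2 * N ^ 4 * exp (9*u) - 3 * pi * N\<^sup>2 * exp (5*u)\<bar>
        \<le> 2 * pi\<^sup>2 * (N ^ 4 * exp (9*u)) + 3 * pi * (N ^ 4 * exp (9 * u))"
      using mult_left_mono[of "N\<^sup>2 * exp (5 * u)" "N ^ 4 * exp (9 * u)" "3 * pi"]
      by (intro order_trans[OF abs_triangle_ineq4]) (simp add: abs_mult mult.assoc)
    also have "\<dots> = (2 * pi\<^sup>2 + 3 * pi) * (N ^ 4 * exp (9 * u))" by (simp add: algebra_simps)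
    also have "\<dots> \<le> (2 * pi\<^sup>2 + 3 * pi) * (6 * exp v / N\<^sup>2)"
      using main by (intro mult_left_mono) auto
    also have "\<dots> = D * exp v / N\<^sup>2" by (simp add: D_def)
    finally have 1: "\<bar>2 * pi\<^sup>2 * N ^ 4 * exp (9*u) - 3 * pi * N\<^sup>2 * exp (5*u)\<bar> \<le> D * exp v / N\<^sup>2" .
    have "norm (t u n) = \<bar>2 * pi\<^sup>2 * N ^ 4 * exp (9*u) - 3 * pi * N\<^sup>2 * exp (5*u)\<bar> * exp (- pi * v)"
      by (simp add: t_def N_def v_def abs_mult mult.assoc)
    also have "\<dots> \<le> (D * exp v / N\<^sup>2) * exp (- 2 * v)"
      using 1 pi_ge_two \<open>v > 0\<close> by (intro mult_mono) (auto simp: D_def)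
    also have "\<dots> = D * (exp v * exp (- 2 * v)) * (1 / N\<^sup>2)" by simp
    also have "exp v * exp (- 2 * v) = exp (- v)" by (simp add: mult_exp_exp)
    also have "D * exp (- v) * (1 / N\<^sup>2) \<le> D * exp (- (u ^ 3)) * (1 / N\<^sup>2)"
      using uv by (intro mult_right_mono mult_left_mono) (auto simp: D_def)
    finally show ?thesis by (simp add: N_def add.commute)
  qed
  have sums: "(\<lambda>n. D * exp (- (u ^ 3)) * (1 / (real n + 1)\<^sup>2)) sums (D * exp (- (u ^ 3)) * (pi\<^sup>2 / 6))"
    using sums_mult[OF inverse_squares_sums, of "D * exp (- (u ^ 3))"] by (simp add: add.commute)
  have "norm (\<Sum>n. t u n) \<le> (\<Sum>n. D * exp (- (u ^ 3)) * (1 / (real n + 1)\<^sup>2))"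
    using sums by (intro norm_suminf_le term_le) (auto simp: sums_iff)
  also have "\<dots> = D * exp (- (u ^ 3)) * (pi\<^sup>2 / 6)" using sums by (simp add: sums_iff)
  finally show "\<bar>Phi u\<bar> \<le> D * (pi\<^sup>2 / 6) * exp (- (u ^ 3))"
    by (simp add: Phi_def t_def mult_ac)
qed

text \<open>
  The cut-off at \<open>0\<close> is part of the weight so that all integrals run over the whole line; the
  powers of \<open>u\<close> are those produced by differentiation in \<open>z\<close> and \<open>\<tau>\<close>.
\<close>

definition weight :: "nat \<Rightarrow> real \<Rightarrow> real \<Rightarrow> real" where
  "weight k \<tau> u = indicator {0..} u * (u ^ k * exp (\<tau> * u\<^sup>2) * Phi u)"

lemma weight_measurable [measurable]: "weight k \<tau> \<in> borel_measurable borel"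
proof -
  have [measurable]: "Phi \<in> borel_measurable borel"
    unfolding Phi_def[abs_def] by measurable
  show ?thesis unfolding weight_def[abs_def] by measurable
qed

lemma integrable_exp_decay_halfline: "integrable lborel (\<lambda>u::real. indicator {0..} u * exp (- u))"
proof (rule integrableI_nn_integral_finite)
  have "((\<lambda>u::real. - exp (- u)) \<longlongrightarrow> 0) at_top" by real_asymp
  then have "(\<integral>\<^sup>+ u. ennreal (exp (- u)) * indicator {0..} u \<partial>lborel) = 0 - (- exp (- (0::real)))"
    by (intro nn_integral_FTC_atLeast) (auto intro!: derivative_eq_intros)
  moreover have "(\<integral>\<^sup>+ u. ennreal (indicator {0..} u * exp (- u)) \<partial>lborel)
      = (\<integral>\<^sup>+ u. ennreal (exp (- u)) * indicator {0..} u \<partial>lborel)"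
    by (intro nn_integral_cong) (auto simp: indicator_def)
  ultimately show "(\<integral>\<^sup>+ u. ennreal (indicator {0..} u * exp (- u)) \<partial>lborel) = ennreal 1" by simp
qed auto

text \<open>
  Makes the linear and quadratic exponents harmless against the decay of \<open>Phi\<close>: a multiple \<open>k u\<^sup>2\<close> exceeds
  \<open>u\<^sup>3\<close> only for \<open>u < k\<close>, where it is at most \<open>k\<^sup>3\<close>.
\<close>

lemma cubic_dominates:
  fixes p q u :: real
  assumes "0 \<le> p" "0 \<le> q" "0 \<le> u"
  shows "p * u + q * u\<^sup>2 \<le> u ^ 3 + p + (p + q) ^ 3"
proof -
  have "0 \<le> p * ((u - 1)\<^sup>2 + u)" using assms by (intro mult_nonneg_nonneg) auto
  then have 1: "p * u \<le> p + p * u\<^sup>2" by (simp add: power2_eq_square algebra_simps)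
  have 2: "(p + q) * u\<^sup>2 \<le> u ^ 3 + (p + q) ^ 3"
  proof (cases "p + q \<le> u")
    case True
    then have "(p + q) * u\<^sup>2 \<le> u * u\<^sup>2" by (intro mult_right_mono) auto
    also have "\<dots> = u ^ 3" by (simp add: power2_eq_square power3_eq_cube)
    finally show ?thesis using assms by (simp add: add_increasing2)
  next
    case False
    then have "(p + q) * u\<^sup>2 \<le> (p + q) * (p + q)\<^sup>2"
      using assms by (intro mult_left_mono power_mono) auto
    also have "\<dots> = (p + q) ^ 3" by (simp add: power2_eq_square power3_eq_cube)
    finally show ?thesis using assms by (simp add: add_increasing)
  qed
  show ?thesis using 1 2 by (simp add: algebra_simps)
qed

lemma weight_integrable: "integrable lborel (\<lambda>u. weight k \<tau> u * exp (b * u))"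
proof -
  obtain C where C: "0 \<le> C" "\<And>u. 0 \<le> u \<Longrightarrow> \<bar>Phi u\<bar> \<le> C * exp (- (u ^ 3))"
    using Phi_super_gaussian_decay by blast
  define p q where "p = \<bar>b\<bar> + 2" and "q = \<bar>\<tau>\<bar>"
  define M where "M = C * fact k * exp (p + (p + q) ^ 3)"
  show ?thesis
  proof (rule Bochner_Integration.integrable_bound)
    show "integrable lborel (\<lambda>u. M * (indicator {0..} u * exp (- u)))"
      by (intro integrable_mult_right integrable_exp_decay_halfline)
    show "AE u in lborel. norm (weight k \<tau> u * exp (b * u)) \<le> norm (M * (indicator {0..} u * exp (- u)))"
    proof (intro AE_I2)
      fix u :: real
      show "norm (weight k \<tau> u * exp (b * u)) \<le> norm (M * (indicator {0..} u * exp (- u)))"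
      proof (cases "0 \<le> u")
        case True
        have "norm (weight k \<tau> u * exp (b * u)) = u ^ k * exp (\<tau> * u\<^sup>2) * \<bar>Phi u\<bar> * exp (b * u)"
          using True by (simp add: weight_def abs_mult)
        also have "\<dots> \<le> (fact k * exp u) * exp (q * u\<^sup>2) * (C * exp (- (u ^ 3))) * exp (\<bar>b\<bar> * u)"
          using True C by (intro mult_mono power_le_fact_times_exp) (auto simp: q_def intro!: mult_right_mono)
        also have "\<dots> = C * fact k * exp (p * u + q * u\<^sup>2 - u ^ 3 - u)"
        proof -
          have "p * u + q * u\<^sup>2 - u ^ 3 - u = u + q * u\<^sup>2 + - (u ^ 3) + \<bar>b\<bar> * u"
            by (simp add: p_def algebra_simps)
          then show ?thesis by (simp only: exp_add mult_ac)
        qed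
        also have "\<dots> \<le> C * fact k * exp (p + (p + q) ^ 3 - u)"
          using cubic_dominates[of p q u] True C by (intro mult_left_mono) (auto simp: p_def q_def)
        also have "\<dots> = M * exp (- u)" by (simp add: M_def exp_diff exp_minus divide_simps)
        finally show ?thesis using True C by (simp add: M_def)
      qed (simp add: weight_def)
    qed
  qed measurable
qed

lemma weight_abs_integrable: "integrable lborel (\<lambda>u. \<bar>weight k \<tau> u\<bar> * exp (b * u))"
  using integrable_norm[OF weight_integrable[of k \<tau> b]] by (simp add: abs_mult)

lemma weight_complex_integrable:
  "integrable lborel (\<lambda>u. of_real (weight k \<tau> u) * exp (s * of_real u) :: complex)"
  by (rule Bochner_Integration.integrable_bound[OF weight_abs_integrable[of k \<tau> "Re s"]]) (auto simp: norm_mult)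

text \<open>
  Splitting the cosine in \<open>H\<close> into exponentials reduces \<open>H\<close> and its derivatives to these two-sided Laplace
  transforms, for which differentiation only raises \<open>k\<close>.
\<close>

definition exp_moment :: "nat \<Rightarrow> real \<Rightarrow> complex \<Rightarrow> complex" where
  "exp_moment k \<tau> s = (LINT u|lborel. of_real (weight k \<tau> u) * exp (s * of_real u))"

text \<open>
  The first order Taylor remainder of the exponential function under the integral sign.  With \<open>p u = u\<close> it is
  differentiation in \<open>z\<close>, with \<open>p u = u\<^sup>2\<close> differentiation in the heat time.
\<close>

lemma exp_perturbation_of_integral:
  fixes V :: "real \<Rightarrow> complex" and p :: "real \<Rightarrow> real" and h :: complex
  assumes int: "integrable M V" "integrable M (\<lambda>u. V u * of_real (p u))"
      "integrable M (\<lambda>u. V u * exp (h * of_real (p u)))"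
      "integrable M (\<lambda>u. norm (V u) * (p u)\<^sup>2 * exp \<bar>p u\<bar>)"
    and h: "norm h \<le> 1"
  shows "norm ((LINT u|M. V u * exp (h * of_real (p u))) - (LINT u|M. V u) - h * (LINT u|M. V u * of_real (p u)))
         \<le> (norm h)\<^sup>2 * (LINT u|M. norm (V u) * (p u)\<^sup>2 * exp \<bar>p u\<bar>)"
proof -
  have "(LINT u|M. V u * exp (h * of_real (p u))) - (LINT u|M. V u) - h * (LINT u|M. V u * of_real (p u))
      = (LINT u|M. V u * exp (h * of_real (p u)) - V u - h * (V u * of_real (p u)))"
    using int by simp
  also have "norm \<dots> \<le> (LINT u|M. (norm h)\<^sup>2 * (norm (V u) * (p u)\<^sup>2 * exp \<bar>p u\<bar>))"
  proof (rule Bochner_Integration.integral_norm_bound_integral)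
    fix u
    define x where "x = h * of_real (p u)"
    have x: "norm x \<le> \<bar>p u\<bar>" using mult_right_mono[OF h, of "\<bar>p u\<bar>"] by (simp add: x_def norm_mult)
    have "norm (exp x - 1 - x) \<le> exp (norm x) * (norm x)\<^sup>2"
      using Taylor_exp_field[of x 1] by (simp add: power2_eq_square algebra_simps)
    also have "\<dots> \<le> exp \<bar>p u\<bar> * (norm x)\<^sup>2"
      using x by (intro mult_right_mono) auto
    finally have "norm (V u) * norm (exp x - 1 - x) \<le> norm (V u) * (exp \<bar>p u\<bar> * (norm x)\<^sup>2)"
      by (rule mult_left_mono) simp
    then show "norm (V u * exp (h * of_real (p u)) - V u - h * (V u * of_real (p u)))
        \<le> (norm h)\<^sup>2 * (norm (V u) * (p u)\<^sup>2 * exp \<bar>p u\<bar>)"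
      by (simp add: x_def norm_mult[symmetric] power_mult_distrib algebra_simps)
         (simp add: norm_mult power_mult_distrib mult_ac)
  qed (use int in auto)
  finally show ?thesis using int by simp
qed

lemma has_field_derivative_of_quadratic_remainder:
  fixes f :: "complex \<Rightarrow> complex"
  assumes "\<And>h. norm h \<le> 1 \<Longrightarrow> norm (f (x + h) - f x - h * D) \<le> (norm h)\<^sup>2 * B"
  shows "(f has_field_derivative D) (at x)"
  unfolding DERIV_def
proof (rule LIM_zero_cancel, rule Lim_null_comparison)
  show "((\<lambda>h::complex. norm h * B) \<longlongrightarrow> 0) (at 0)"
    by (auto intro!: tendsto_eq_intros)
  have "\<forall>\<^sub>F h::complex in at 0. norm h < 1"
    using eventually_at_ball[of 1 "0::complex" UNIV] by (auto elim: eventually_mono)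
  moreover have "\<forall>\<^sub>F h::complex in at 0. h \<noteq> 0" by (simp add: eventually_at_filter)
  ultimately show "\<forall>\<^sub>F h in at 0. norm ((f (x + h) - f x) / h - D) \<le> norm h * B"
  proof eventually_elim
    case (elim h)
    have "norm ((f (x + h) - f x) / h - D) = norm (f (x + h) - f x - h * D) / norm h"
      using elim by (simp add: norm_divide[symmetric] diff_divide_distrib)
    also have "\<dots> \<le> (norm h)\<^sup>2 * B / norm h"
      using assms[of h] elim by (intro divide_right_mono) auto
    finally show ?case using elim by (simp add: power2_eq_square)
  qed
qed

lemma exp_moment_has_field_derivative: "(exp_moment k \<tau> has_field_derivative exp_moment (Suc k) \<tau> s) (at s)"
proof (rule has_field_derivative_of_quadratic_remainder)
  fix h :: complex assume h: "norm h \<le> 1"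
  define V where "V = (\<lambda>u. of_real (weight k \<tau> u) * exp (s * of_real u) :: complex)"
  have 1: "(\<lambda>u. V u * exp (h * of_real u)) = (\<lambda>u. of_real (weight k \<tau> u) * exp ((s + h) * of_real u))"
    by (simp add: V_def distrib_right exp_add mult.assoc)
  have 2: "(\<lambda>u. V u * of_real u) = (\<lambda>u. of_real (weight (Suc k) \<tau> u) * exp (s * of_real u))"
    by (auto simp: V_def weight_def mult_ac)
  have 3: "(\<lambda>u. norm (V u) * u\<^sup>2 * exp \<bar>u\<bar>) = (\<lambda>u. \<bar>weight (k + 2) \<tau> u\<bar> * exp ((Re s + 1) * u))"
    by (auto simp: V_def weight_def norm_mult norm_power abs_mult distrib_left distrib_right exp_add power_add
        indicator_def power_abs power2_eq_square mult_ac)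
  show "norm (exp_moment k \<tau> (s + h) - exp_moment k \<tau> s - h * exp_moment (Suc k) \<tau> s)
      \<le> (norm h)\<^sup>2 * (LINT u|lborel. norm (V u) * u\<^sup>2 * exp \<bar>u\<bar>)"
    using exp_perturbation_of_integral[of lborel V "\<lambda>u. u" h] h
    unfolding 1 2 3 exp_moment_def
    by (simp add: V_def weight_complex_integrable weight_abs_integrable)
qed

text \<open>
  The remainder integral depends on \<open>s\<close> only through its norm.  This uniformity is needed because \<open>s\<close>
  moves together with the time when a zero is followed.
\<close>

lemma exp_moment_time_remainder:
  assumes "\<bar>t - \<tau>\<bar> \<le> 1"
  shows "norm (exp_moment k t s - exp_moment k \<tau> s - of_real (t - \<tau>) * exp_moment (k + 2) \<tau> s)
      \<le> (t - \<tau>)\<^sup>2 * (LINT u|lborel. \<bar>weight (k + 4) (\<tau> + 1) u\<bar> * exp (norm s * u))"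
proof -
  define V where "V = (\<lambda>u. of_real (weight k \<tau> u) * exp (s * of_real u) :: complex)"
  define h where "h = complex_of_real (t - \<tau>)"
  have 1: "(\<lambda>u. V u * exp (h * of_real (u\<^sup>2))) = (\<lambda>u. of_real (weight k t u) * exp (s * of_real u))"
  proof
    fix u
    have "exp (h * of_real (u\<^sup>2)) = of_real (exp ((t - \<tau>) * u\<^sup>2))"
      unfolding h_def of_real_mult[symmetric] exp_of_real ..
    moreover have "weight k t u = weight k \<tau> u * exp ((t - \<tau>) * u\<^sup>2)"
      by (simp add: weight_def left_diff_distrib exp_diff)
    ultimately show "V u * exp (h * of_real (u\<^sup>2)) = of_real (weight k t u) * exp (s * of_real u)"
      by (simp add: V_def)
  qed
  have 2: "(\<lambda>u. V u * of_real (u\<^sup>2)) = (\<lambda>u. of_real (weight (k + 2) \<tau> u) * exp (s * of_real u))"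
    by (auto simp: V_def weight_def power_add power2_eq_square mult_ac)
  have 3: "(\<lambda>u. norm (V u) * (u\<^sup>2)\<^sup>2 * exp \<bar>u\<^sup>2\<bar>) = (\<lambda>u. \<bar>weight (k + 4) (\<tau> + 1) u\<bar> * exp (Re s * u))"
    by (auto simp: V_def weight_def norm_mult norm_power abs_mult distrib_right exp_add power_add
        indicator_def power_abs mult_ac simp flip: power_mult)
  have "norm (exp_moment k t s - exp_moment k \<tau> s - h * exp_moment (k + 2) \<tau> s)
      \<le> (norm h)\<^sup>2 * (LINT u|lborel. \<bar>weight (k + 4) (\<tau> + 1) u\<bar> * exp (Re s * u))"
    using exp_perturbation_of_integral[of lborel V "\<lambda>u. u\<^sup>2" h] assms
    unfolding 1 2 3 exp_moment_def
    by (simp add: V_def weight_complex_integrable weight_abs_integrable h_def flip: of_real_diff)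
  also have "\<dots> \<le> (norm h)\<^sup>2 * (LINT u|lborel. \<bar>weight (k + 4) (\<tau> + 1) u\<bar> * exp (norm s * u))"
  proof (rule mult_left_mono, rule integral_mono)
    fix u
    show "\<bar>weight (k + 4) (\<tau> + 1) u\<bar> * exp (Re s * u) \<le> \<bar>weight (k + 4) (\<tau> + 1) u\<bar> * exp (norm s * u)"
    proof (cases "0 \<le> u")
      case True
      then show ?thesis using complex_Re_le_cmod[of s] by (intro mult_left_mono) (auto intro: mult_right_mono)
    qed (simp add: weight_def)
  qed (simp_all add: weight_abs_integrable)
  finally show ?thesis unfolding h_def by (simp flip: of_real_diff)
qed

text \<open>
  By \<open>|s| u \<le> \<epsilon> |s|\<^sup>2 + u\<^sup>2 / (4 \<epsilon>)\<close>, the growth in \<open>s\<close> is traded for a later heat time, at which the weight is still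
  integrable.
\<close>

lemma exp_moment_norm_le:
  assumes "0 < \<epsilon>"
  shows "norm (exp_moment 0 \<tau> s) \<le> (LINT u|lborel. \<bar>weight 0 (\<tau> + 1 / (4 * \<epsilon>)) u\<bar>) * exp (\<epsilon> * (norm s)\<^sup>2)"
proof -
  have "norm (exp_moment 0 \<tau> s) \<le> (LINT u|lborel. \<bar>weight 0 (\<tau> + 1 / (4 * \<epsilon>)) u\<bar> * exp (\<epsilon> * (norm s)\<^sup>2))"
    unfolding exp_moment_def
  proof (rule Bochner_Integration.integral_norm_bound_integral[OF weight_complex_integrable])
    show "integrable lborel (\<lambda>u. \<bar>weight 0 (\<tau> + 1 / (4 * \<epsilon>)) u\<bar> * exp (\<epsilon> * (norm s)\<^sup>2))"
      using weight_abs_integrable[of 0 "\<tau> + 1 / (4 * \<epsilon>)" 0] by simp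
    fix u :: real
    show "norm (of_real (weight 0 \<tau> u) * exp (s * of_real u))
        \<le> \<bar>weight 0 (\<tau> + 1 / (4 * \<epsilon>)) u\<bar> * exp (\<epsilon> * (norm s)\<^sup>2)"
    proof (cases "0 \<le> u")
      case True
      have "0 \<le> (2 * \<epsilon> * norm s - u)\<^sup>2 / (4 * \<epsilon>)" using assms by simp
      also have "\<dots> = \<epsilon> * (norm s)\<^sup>2 - norm s * u + u\<^sup>2 / (4 * \<epsilon>)"
        using assms by (simp add: power2_eq_square field_simps)
      finally have "Re s * u \<le> u\<^sup>2 / (4 * \<epsilon>) + \<epsilon> * (norm s)\<^sup>2"
        using True mult_right_mono[OF complex_Re_le_cmod[of s] True] by linarith
      then have "exp (Re s * u) \<le> exp (u\<^sup>2 / (4 * \<epsilon>)) * exp (\<epsilon> * (norm s)\<^sup>2)"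
        by (simp add: mult_exp_exp)
      then have "\<bar>weight 0 \<tau> u\<bar> * exp (Re s * u)
          \<le> \<bar>weight 0 \<tau> u\<bar> * (exp (u\<^sup>2 / (4 * \<epsilon>)) * exp (\<epsilon> * (norm s)\<^sup>2))"
        by (rule mult_left_mono) simp
      then show ?thesis
        by (simp add: norm_mult weight_def abs_mult distrib_left distrib_right exp_add mult_ac)
    qed (simp add: weight_def)
  qed
  then show ?thesis by simp
qed

lemma H_eq_exp_moment: "H \<tau> z = (exp_moment 0 \<tau> (\<i> * z) + exp_moment 0 \<tau> (- (\<i> * z))) / 2"
proof -
  have "H \<tau> z = (LINT u|lborel. (of_real (weight 0 \<tau> u) * exp ((\<i> * z) * of_real u)
      + of_real (weight 0 \<tau> u) * exp ((- (\<i> * z)) * of_real u)) / 2)"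
    unfolding H_def set_lebesgue_integral_def
    by (intro Bochner_Integration.integral_cong)
       (auto simp: weight_def indicator_def cos_exp_eq algebra_simps)
  also have "\<dots> = ((LINT u|lborel. of_real (weight 0 \<tau> u) * exp ((\<i> * z) * of_real u))
      + (LINT u|lborel. of_real (weight 0 \<tau> u) * exp ((- (\<i> * z)) * of_real u))) / 2"
    by (subst integral_divide_zero, subst Bochner_Integration.integral_add)
       (rule weight_complex_integrable refl)+
  finally show ?thesis by (simp only: exp_moment_def)
qed

lemma exp_moment_cnj: "exp_moment k \<tau> (cnj s) = cnj (exp_moment k \<tau> s)"
proof -
  have "cnj (exp_moment k \<tau> s) = (LINT u|lborel. cnj (of_real (weight k \<tau> u) * exp (s * of_real u)))"
    unfolding exp_moment_def by (rule Bochner_Integration.integral_cnj[symmetric])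
  also have "\<dots> = exp_moment k \<tau> (cnj s)" by (simp add: exp_moment_def exp_cnj del: Bochner_Integration.integral_cnj)
  finally show ?thesis ..
qed

section \<open>The heat flow and the motion of its zeros\<close>

definition H' :: "real \<Rightarrow> complex \<Rightarrow> complex" where
  "H' \<tau> z = \<i> * (exp_moment 1 \<tau> (\<i> * z) - exp_moment 1 \<tau> (- (\<i> * z))) / 2"

definition H'' :: "real \<Rightarrow> complex \<Rightarrow> complex" where
  "H'' \<tau> z = - (exp_moment 2 \<tau> (\<i> * z) + exp_moment 2 \<tau> (- (\<i> * z))) / 2"

lemma exp_moment_compose_rotation_deriv:
  assumes "c \<in> {\<i>, - \<i>}"
  shows "((\<lambda>z. exp_moment k \<tau> (c * z)) has_field_derivative exp_moment (Suc k) \<tau> (c * z) * c) (at z)"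
  by (rule DERIV_chain2[OF exp_moment_has_field_derivative]) (auto intro!: derivative_eq_intros)

lemma H_has_field_derivative: "(H \<tau> has_field_derivative H' \<tau> z) (at z)"
  unfolding H_eq_exp_moment[abs_def] H'_def
  using DERIV_cdivide[OF DERIV_add[OF exp_moment_compose_rotation_deriv[of \<i> 0 \<tau> z] exp_moment_compose_rotation_deriv[of "- \<i>" 0 \<tau> z]], of 2]
  by (simp add: algebra_simps)

lemma H'_has_field_derivative: "(H' \<tau> has_field_derivative H'' \<tau> z) (at z)"
  unfolding H'_def[abs_def] H''_def
  using DERIV_cdivide[OF DERIV_cmult[OF DERIV_diff[OF exp_moment_compose_rotation_deriv[of \<i> 1 \<tau> z] exp_moment_compose_rotation_deriv[of "- \<i>" 1 \<tau> z]], of \<i>], of 2]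
  by (simp add: algebra_simps numeral_2_eq_2)

lemma isCont_H'': "isCont (H'' \<tau>) z"
proof -
  have "isCont (\<lambda>z. exp_moment 2 \<tau> (c * z)) z" if "c \<in> {\<i>, - \<i>}" for c
    using exp_moment_compose_rotation_deriv[OF that] DERIV_isCont by blast
  from this[of \<i>] this[of "- \<i>"] show ?thesis
    unfolding H''_def[abs_def] by (auto intro!: continuous_intros)
qed

lemma deriv_H: "deriv (H \<tau>) = H' \<tau>" "deriv (H' \<tau>) = H'' \<tau>"
  using H_has_field_derivative H'_has_field_derivative DERIV_imp_deriv by blast+

lemma H_entire: "H \<tau> holomorphic_on UNIV"
  using H_has_field_derivative by (auto simp: holomorphic_on_open)

lemma H_cnj: "H \<tau> (cnj z) = cnj (H \<tau> z)"
proof -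
  have 1: "\<i> * cnj z = cnj (- (\<i> * z))" and 2: "- (\<i> * cnj z) = cnj (\<i> * z)" by simp_all
  show ?thesis unfolding H_eq_exp_moment 2 unfolding 1 exp_moment_cnj by simp
qed

lemma H_subquadratic_growth: "subquadratic_growth (H \<tau>)"
  unfolding subquadratic_growth_def
proof (intro allI impI)
  fix \<epsilon> :: real assume \<epsilon>: "0 < \<epsilon>"
  define C where "C = (LINT u|lborel. \<bar>weight 0 (\<tau> + 1 / (4 * \<epsilon>)) u\<bar>)"
  have "norm (H \<tau> w) \<le> C * exp (\<epsilon> * (norm w)\<^sup>2)" for w
  proof -
    have "norm (H \<tau> w) \<le> (norm (exp_moment 0 \<tau> (\<i> * w)) + norm (exp_moment 0 \<tau> (- (\<i> * w)))) / 2"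
      using norm_triangle_ineq by (simp add: H_eq_exp_moment norm_divide)
    then show ?thesis
      using exp_moment_norm_le[OF \<epsilon>, of \<tau> "\<i> * w"] exp_moment_norm_le[OF \<epsilon>, of \<tau> "- (\<i> * w)"]
      by (simp add: C_def norm_mult)
  qed
  then show "\<exists>C. \<forall>w. norm (H \<tau> w) \<le> C * exp (\<epsilon> * (norm w)\<^sup>2)" by blast
qed

text \<open>
  The backward heat equation with a quantitative remainder, uniform for \<open>w\<close> in a disc.
\<close>

lemma H_backward_heat_remainder:
  assumes r: "norm w \<le> r" and t: "\<bar>t - \<tau>\<bar> \<le> 1"
  shows "norm (H t w - H \<tau> w + of_real (t - \<tau>) * H'' \<tau> w)
      \<le> (t - \<tau>)\<^sup>2 * (LINT u|lborel. \<bar>weight 4 (\<tau> + 1) u\<bar> * exp (r * u))"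
proof -
  define B where "B = (\<lambda>r. LINT u|lborel. \<bar>weight 4 (\<tau> + 1) u\<bar> * exp (r * u))"
  define X where "X = (\<lambda>s. exp_moment 0 t s - exp_moment 0 \<tau> s - of_real (t - \<tau>) * exp_moment 2 \<tau> s)"
  have "B (norm w) \<le> B r"
    unfolding B_def
  proof (intro integral_mono weight_abs_integrable)
    fix u :: real
    show "\<bar>weight 4 (\<tau> + 1) u\<bar> * exp (norm w * u) \<le> \<bar>weight 4 (\<tau> + 1) u\<bar> * exp (r * u)"
    proof (cases "0 \<le> u")
      case True
      then show ?thesis using r by (intro mult_left_mono) (auto intro: mult_right_mono)
    qed (simp add: weight_def)
  qed
  have X: "norm (X s) \<le> (t - \<tau>)\<^sup>2 * B r" if "norm s = norm w" for s
  proof -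
    have "norm (X s) \<le> (t - \<tau>)\<^sup>2 * B (norm w)"
      using exp_moment_time_remainder[OF t, of 0 s] that unfolding X_def B_def by (simp add: numeral_2_eq_2)
    also have "\<dots> \<le> (t - \<tau>)\<^sup>2 * B r" using \<open>B (norm w) \<le> B r\<close> by (intro mult_left_mono) auto
    finally show ?thesis .
  qed
  have "H t w - H \<tau> w + of_real (t - \<tau>) * H'' \<tau> w = (X (\<i> * w) + X (- (\<i> * w))) / 2"
    by (simp add: H_eq_exp_moment H''_def X_def field_simps)
  also have "norm \<dots> \<le> (norm (X (\<i> * w)) + norm (X (- (\<i> * w)))) / 2"
    using norm_triangle_ineq[of "X (\<i> * w)" "X (- (\<i> * w))"] by (simp add: norm_divide)
  also have "\<dots> \<le> (t - \<tau>)\<^sup>2 * B r"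
    using X[of "\<i> * w"] X[of "- (\<i> * w)"] by (simp add: norm_mult)
  finally show ?thesis by (simp add: B_def)
qed

text \<open>
  Since \<open>H t (z t) = 0 = H \<tau> (z \<tau>)\<close>, the change of \<open>H \<tau>\<close> along the branch balances the change of \<open>H\<close> in time
  at the fixed point \<open>z t\<close>, which is \<open>- (t - \<tau>) H'' \<tau> (z t)\<close> up to second order.  Dividing by \<open>t - \<tau>\<close> shows that
  the difference quotient of the branch converges.
\<close>

proposition zero_branch_velocity:
  assumes branch: "zero_branch I z" and \<tau>: "\<tau> \<in> I" and simple: "H' \<tau> (z \<tau>) \<noteq> 0"
  shows "(z has_vector_derivative H'' \<tau> (z \<tau>) / H' \<tau> (z \<tau>)) (at \<tau> within I)"
proof -
  have cont: "(z \<longlongrightarrow> z \<tau>) (at \<tau> within I)"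
    using branch \<tau> by (auto simp: zero_branch_def continuous_on_def)
  have zero: "H t (z t) = 0" if "t \<in> I" for t
    using branch that by (auto simp: zero_branch_def zeros_def)
  \<comment> \<open>\<open>g\<close> is the difference quotient of \<open>H \<tau>\<close> at \<open>z \<tau>\<close>, continued by the derivative\<close>
  obtain g where g: "\<And>w. H \<tau> w - H \<tau> (z \<tau>) = g w * (w - z \<tau>)" "isCont g (z \<tau>)" "g (z \<tau>) = H' \<tau> (z \<tau>)"
    using H_has_field_derivative[of \<tau> "z \<tau>"] unfolding CARAT_DERIV by blast
  define r where "r = norm (z \<tau>) + 1"
  define B where "B = (LINT u|lborel. \<bar>weight 4 (\<tau> + 1) u\<bar> * exp (r * u))"
  define E where "E = (\<lambda>t. H t (z t) - H \<tau> (z t) + of_real (t - \<tau>) * H'' \<tau> (z t))"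
  have gz: "((\<lambda>t. g (z t)) \<longlongrightarrow> H' \<tau> (z \<tau>)) (at \<tau> within I)"
    using isCont_tendsto_compose[OF g(2) cont] g(3) by simp
  have H''z: "((\<lambda>t. H'' \<tau> (z t)) \<longlongrightarrow> H'' \<tau> (z \<tau>)) (at \<tau> within I)"
    using isCont_tendsto_compose[OF isCont_H'' cont] .
  have "\<forall>\<^sub>F t in at \<tau> within I. norm (z t) < r"
    using order_tendstoD(2)[OF tendsto_norm[OF cont], of r] by (simp add: r_def)
  moreover have near: "\<forall>\<^sub>F t in at \<tau> within I. t \<in> I \<and> t \<noteq> \<tau> \<and> \<bar>t - \<tau>\<bar> < 1"
    unfolding eventually_at by (intro exI[of _ 1]) (auto simp: dist_real_def)
  ultimately have "\<forall>\<^sub>F t in at \<tau> within I. norm (E t / of_real (t - \<tau>)) \<le> \<bar>t - \<tau>\<bar> * B"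
  proof eventually_elim
    case (elim t)
    have "norm (E t) \<le> (t - \<tau>)\<^sup>2 * B"
      unfolding E_def B_def by (rule H_backward_heat_remainder) (use elim in auto)
    also have "\<dots> = \<bar>t - \<tau>\<bar> * B * \<bar>t - \<tau>\<bar>" by (simp add: power2_eq_square)
    finally show ?case using elim by (simp add: norm_divide divide_le_eq flip: of_real_diff)
  qed
  moreover have "((\<lambda>t. \<bar>t - \<tau>\<bar> * B) \<longlongrightarrow> 0) (at \<tau> within I)"
    by (auto intro!: tendsto_eq_intros)
  ultimately have E0: "((\<lambda>t. E t / of_real (t - \<tau>)) \<longlongrightarrow> 0) (at \<tau> within I)"
    by (rule Lim_null_comparison)
  have "((\<lambda>t. (H'' \<tau> (z t) - E t / of_real (t - \<tau>)) / g (z t)) \<longlongrightarrow> (H'' \<tau> (z \<tau>) - 0) / H' \<tau> (z \<tau>)) (at \<tau> within I)"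
    by (intro tendsto_intros H''z E0 gz simple)
  moreover have "\<forall>\<^sub>F t in at \<tau> within I.
      (H'' \<tau> (z t) - E t / of_real (t - \<tau>)) / g (z t) = (z t - z \<tau>) / of_real (t - \<tau>)"
  proof -
    have "\<forall>\<^sub>F t in at \<tau> within I. g (z t) \<noteq> 0"
      using tendsto_imp_eventually_ne[OF gz simple] .
    with near show ?thesis
    proof eventually_elim
      case (elim t)
      have "E t = of_real (t - \<tau>) * H'' \<tau> (z t) - g (z t) * (z t - z \<tau>)"
        using g(1)[of "z t"] zero[of t] zero[OF \<tau>] elim by (simp add: E_def)
      moreover have "complex_of_real (t - \<tau>) \<noteq> 0" using elim by simp
      ultimately have "H'' \<tau> (z t) - E t / of_real (t - \<tau>) = g (z t) * (z t - z \<tau>) / of_real (t - \<tau>)"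
        by (simp add: diff_divide_distrib del: of_real_diff)
      then show ?case using elim by simp
    qed
  qed
  ultimately have "((\<lambda>t. (z t - z \<tau>) / of_real (t - \<tau>)) \<longlongrightarrow> H'' \<tau> (z \<tau>) / H' \<tau> (z \<tau>)) (at \<tau> within I)"
    by (simp add: filterlim_cong)
  then show ?thesis
    unfolding has_vector_derivative_complex_iff has_field_derivative_iff
    by (auto dest: tendsto_Re tendsto_Im simp flip: of_real_diff)
qed

theorem theorem2p1:
  fixes I :: "real set" and z :: "real \<Rightarrow> complex"
  assumes "is_interval I" and "\<exists>a\<in>I. \<exists>b\<in>I. a < b"
    and "zero_branch I z"
    and "\<And>\<tau>. \<tau> \<in> I \<Longrightarrow> Im (z \<tau>) > 0"
    and "\<And>\<tau>. \<tau> \<in> I \<Longrightarrow> simple_zero \<tau> (z \<tau>)"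
    and "\<And>\<tau>. \<tau> \<in> I \<Longrightarrow> maximal_height_zero \<tau> (z \<tau>)"
  shows "\<forall>\<tau>\<in>I. G_term \<tau> (z \<tau>) summable_on (zeros \<tau> - {z \<tau>, cnj (z \<tau>)})
           \<and> G \<tau> (z \<tau>) \<ge> 0
           \<and> (\<exists>D. ((\<lambda>t. (Im (z t))^2) has_real_derivative D) (at \<tau> within I)
                  \<and> D \<le> - 2 - 4 * (Im (z \<tau>))^2 * G \<tau> (z \<tau>)
                  \<and> D \<le> - 2)"
proof
  fix \<tau> assume \<tau>: "\<tau> \<in> I"
  define a where "a = z \<tau>"
  define S where "S = zeros \<tau> - {a, cnj a}"
  define v where "v = Im (H'' \<tau> a / H' \<tau> a)"
  have y: "0 < Im a" using assms(4)[OF \<tau>] by (simp add: a_def)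
  have a: "H \<tau> a = 0" "zorder (H \<tau>) a = 1"
    using assms(5)[OF \<tau>] by (simp_all add: simple_zero_def zeros_def a_def)
  have highest: "\<bar>Im \<rho>\<bar> \<le> Im a" if "H \<tau> \<rho> = 0" for \<rho>
    using assms(6)[OF \<tau>] that by (auto simp: maximal_height_zero_def zeros_def a_def)
  have nz: "H \<tau> (a + \<i>) \<noteq> 0" using highest[of "a + \<i>"] y by auto
  have nonneg: "0 \<le> G_term \<tau> a \<rho>" for \<rho>
    using entire_zorder_nonneg[OF H_entire nz] by (simp add: G_term_def)
  have v_le: "v \<le> - 1 / Im a - 2 * Im a * sum (G_term \<tau> a) F" if "finite F" "F \<subseteq> S" for F
    using Im_deriv_ratio_at_highest_zero[OF H_entire H_subquadratic_growth H_cnj a y highest, of F] that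
    unfolding v_def G_term_def deriv_H by (simp add: S_def zeros_def)
  \<comment> \<open>the bound on the partial sums obtained by solving \<open>v_le\<close> for the sum\<close>
  define K where "K = (- 1 / Im a - v) / (2 * Im a)"
  have partial: "sum (G_term \<tau> a) F \<le> K" if "finite F" "F \<subseteq> S" for F
    using v_le[OF that] y by (simp add: K_def field_simps)
  have summable: "G_term \<tau> a summable_on S"
    using nonneg partial by (intro nonneg_bdd_above_summable_on bdd_aboveI2) auto
  have G: "G \<tau> a = infsum (G_term \<tau> a) S" by (simp add: G_def S_def)
  have G0: "0 \<le> G \<tau> a" unfolding G using nonneg by (intro infsum_nonneg)
  have "G \<tau> a \<le> K" unfolding G using summable partial by (rule infsum_le_finite_sums)
  then have bound: "2 * Im a * v \<le> - 2 - 4 * (Im a)\<^sup>2 * G \<tau> a"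
    using y by (simp add: K_def field_simps power2_eq_square)
  have "H' \<tau> a \<noteq> 0"
    using simple_zero_deriv_nonzero[OF H_entire nz a(2)] by (simp add: deriv_H)
  then have "(z has_vector_derivative H'' \<tau> a / H' \<tau> a) (at \<tau> within I)"
    using zero_branch_velocity[OF assms(3) \<tau>] by (simp add: a_def)
  then have "((\<lambda>t. Im (z t)) has_real_derivative v) (at \<tau> within I)"
    by (simp add: has_vector_derivative_complex_iff v_def)
  then have "((\<lambda>t. (Im (z t))\<^sup>2) has_real_derivative 2 * Im a * v) (at \<tau> within I)"
    using DERIV_power[of "\<lambda>t. Im (z t)" v \<tau> I 2] by (simp add: a_def mult_ac)
  moreover have "2 * Im a * v \<le> - 2"
  proof -
    have "0 \<le> 4 * (Im a)\<^sup>2 * G \<tau> a" using G0 by simp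
    then show ?thesis using bound by linarith
  qed
  ultimately show "G_term \<tau> (z \<tau>) summable_on (zeros \<tau> - {z \<tau>, cnj (z \<tau>)})
           \<and> G \<tau> (z \<tau>) \<ge> 0
           \<and> (\<exists>D. ((\<lambda>t. (Im (z t))^2) has_real_derivative D) (at \<tau> within I)
                  \<and> D \<le> - 2 - 4 * (Im (z \<tau>))^2 * G \<tau> (z \<tau>)
                  \<and> D \<le> - 2)"
    using summable G0 bound unfolding S_def a_def by blast
qed

end
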